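(* Let $\mathcal{M}=(E,\mathcal{I})$ be a uniformly dense matroid of rank $r$ with $|E|=n$, whose elements arrive in an arbitrary (adversarially fixed) order $e_1,\dots,e_n$. Let $W=\{w_1>w_2>\dots>w_n\}$ be an arbitrary set of $n$ distinct non-negative weights, and let $\omega:E\to W$ be a uniformly random bijection. Let $\mathrm{ALG}(\omega)$ be the set returned by the following algorithm (which knows $\mathcal{M}$ in advance): (1) If $r<12$, run the optimal algorithm for the classical secretary problem on the $n$ weights (selecting at most one element) and return the resulting singleton (or empty set). (2) Otherwise, start with $\mathrm{ALG}=\emptyset$; observe without selecting the first half of the input $A=\{e_1,\dots,e_{n/2}\}$ and let $w^*$ be the $(\lfloor r/4\rfloor+1)$-st largest weight among the elements of $A$; then for each subsequently arriving element $e\in B=\{e_{n/2+1},\dots,e_n\}$, add $e$ to $\mathrm{ALG}$ if $\omega(e)>w^*$ and $\mathrm{ALG}\cup\{e\}$ is independent; finally return $\mathrm{ALG}$. Then $$\mathbb{E}_\omega\big[w(\mathrm{ALG}(\omega))\big]\ \ge\ \frac{1}{40}\sum_{i=1}^{r} w_i,$$ where $w_1>\dots>w_r$ are the $r$ largest weights in $W$ and $w(S)=\sum_{e\in S}\omega(e)$.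
   Context: A matroid $\mathcal{M}=(E,\mathcal{I})$ is uniformly dense if $\frac{|S|}{\mathrm{rank}(S)}\le \frac{|E|}{\mathrm{rank}(E)}$ for all nonempty $S\subseteq E$ of positive rank (in particular it has no loops). The algorithm is online: elements are revealed one by one together with their weights, and each must be irrevocably accepted or rejected upon arrival. The optimal classical secretary algorithm selects the maximum weight with probability at least $1/e$. *)

theory Defs
  imports "HOL-Probability.Probability" "HOL-Combinatorics.Multiset_Permutations"
begin

locale matroid =
  fixes E :: "'a set" and I :: "'a set set"
  assumes finite_ground: "finite E"
    and indep_subset_ground: "X \<in> I \<Longrightarrow> X \<subseteq> E"
    and empty_indep: "{} \<in> I"
    and indep_subset: "Y \<in> I \<Longrightarrow> X \<subseteq> Y \<Longrightarrow> X \<in> I"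
    and augmentation: "X \<in> I \<Longrightarrow> Y \<in> I \<Longrightarrow> card X < card Y \<Longrightarrow> \<exists>y\<in>Y - X. insert y X \<in> I"

definition matroid_rank :: "'a set set \<Rightarrow> 'a set \<Rightarrow> nat" where
  "matroid_rank I S = Max {card X | X. X \<in> I \<and> X \<subseteq> S}"

text \<open>Only sets of positive rank are constrained, so this inequality on its own does not
  exclude every loop. Theorems assuming it cover all loopless uniformly dense matroids.\<close>

definition uniformly_dense :: "'a set \<Rightarrow> 'a set set \<Rightarrow> bool" where
  "uniformly_dense E I \<longleftrightarrow>
     (\<forall>S\<subseteq>E. S \<noteq> {} \<and> 0 < matroid_rank I S \<longrightarrow>
        real (card S) / real (matroid_rank I S) \<le> real (card E) / real (matroid_rank I E))"

text \<open>In the classical secretary problem the values are unknown in advance and only their order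
  matters: a stopping rule sees, at each arrival, the relative ranks of the items so far (the
  \<open>j\<close>-th relative rank is the rank of item \<open>j\<close> among items \<open>0, \<dots>, j\<close>, where rank \<open>1\<close> is the
  largest), and returns whether the current item is selected. The first selected item is final.\<close>

type_synonym stopping_rule = "nat list \<Rightarrow> bool"

definition relative_ranks :: "'b::linorder list \<Rightarrow> nat list" where
  "relative_ranks xs = map (\<lambda>j. card {i. i \<le> j \<and> xs ! j \<le> xs ! i}) [0..<length xs]"

definition secretary_select :: "stopping_rule \<Rightarrow> 'b::linorder list \<Rightarrow> nat option" where
  "secretary_select \<tau> xs =
     find (\<lambda>t. \<tau> (relative_ranks (take (Suc t) xs))) [0..<length xs]"

definition selects_maximum :: "stopping_rule \<Rightarrow> 'b::linorder list \<Rightarrow> bool" where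
  "selects_maximum \<tau> xs \<longleftrightarrow> (\<exists>t. secretary_select \<tau> xs = Some t \<and> xs ! t = Max (set xs))"

definition secretary_success :: "nat \<Rightarrow> stopping_rule \<Rightarrow> real" where
  "secretary_success n \<tau> =
     measure_pmf.prob (pmf_of_set (permutations_of_set {1..n})) {xs. selects_maximum \<tau> xs}"

definition optimal_secretary_rule :: "nat \<Rightarrow> stopping_rule \<Rightarrow> bool" where
  "optimal_secretary_rule n \<tau> \<longleftrightarrow> (\<forall>\<tau>'. secretary_success n \<tau>' \<le> secretary_success n \<tau>)"

lemma optimal_secretary_rule_exists: "\<exists>\<tau>. optimal_secretary_rule n \<tau>"
proof -
  let ?P = "permutations_of_set {1..n}"
  have P: "finite ?P" "?P \<noteq> {}" by auto
  have "secretary_success n \<tau> \<in> (\<lambda>k. real k / real (card ?P)) ` {..card ?P}" for \<tau>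
    unfolding secretary_success_def measure_pmf_of_set[OF P(2,1)]
    by (rule image_eqI[OF refl]) (simp only: atMost_iff card_mono[OF P(1) Int_lower1])
  then have fin: "finite (range (secretary_success n))"
    by (intro finite_subset[OF _ finite_imageI[OF finite_atMost[of "card ?P"]]]) auto
  then have "Max (range (secretary_success n)) \<in> range (secretary_success n)"
    by (intro Max_in) auto
  then obtain \<tau> where "secretary_success n \<tau> = Max (range (secretary_success n))"
    by (metis rangeE)
  then show ?thesis
    unfolding optimal_secretary_rule_def using fin by (metis Max_ge rangeI)
qed

definition secretary_output :: "stopping_rule \<Rightarrow> 'a list \<Rightarrow> ('a \<Rightarrow> real) \<Rightarrow> 'a set" where
  "secretary_output \<tau> es \<omega> =
     (case secretary_select \<tau> (map \<omega> es) of None \<Rightarrow> {} | Some t \<Rightarrow> {es ! t})"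

definition kth_largest :: "nat \<Rightarrow> real list \<Rightarrow> real" where
  "kth_largest k xs = rev (sort xs) ! (k - 1)"

definition greedy_above :: "'a set set \<Rightarrow> real \<Rightarrow> ('a \<Rightarrow> real) \<Rightarrow> 'a list \<Rightarrow> 'a set" where
  "greedy_above I c \<omega> es =
     foldl (\<lambda>S e. if c < \<omega> e \<and> insert e S \<in> I then insert e S else S) {} es"

text \<open>The list \<open>es\<close> is the arrival order. When \<open>length es\<close> is odd, the observed first half is
  rounded down.\<close>

definition sample_greedy :: "'a set set \<Rightarrow> nat \<Rightarrow> 'a list \<Rightarrow> ('a \<Rightarrow> real) \<Rightarrow> 'a set" where
  "sample_greedy I r es \<omega> =
     (let A = take (length es div 2) es;
          B = drop (length es div 2) es;
          c = kth_largest (r div 4 + 1) (map \<omega> A)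
      in greedy_above I c \<omega> B)"

definition ALG :: "'a set \<Rightarrow> 'a set set \<Rightarrow> stopping_rule \<Rightarrow> 'a list \<Rightarrow> ('a \<Rightarrow> real) \<Rightarrow> 'a set" where
  "ALG E I \<tau> es \<omega> =
     (let r = matroid_rank I E
      in if r < 12 then secretary_output \<tau> es \<omega> else sample_greedy I r es \<omega>)"

text \<open>Functions are restricted to be \<open>undefined\<close> outside \<open>E\<close>, which makes this set finite.\<close>

definition bijections :: "'a set \<Rightarrow> real set \<Rightarrow> ('a \<Rightarrow> real) set" where
  "bijections E W = {\<omega> \<in> E \<rightarrow>\<^sub>E W. bij_betw \<omega> E W}"

end

theory Submission
  imports Defs
begin

text \<open>Rank at least \<open>12\<close>: let \<open>k = \<lfloor>r / 4\<rfloor>\<close> and let \<open>v\<close> be one of the \<open>k + 1\<close> largest weights. If \<open>v\<close>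
  falls on \<open>e \<in> B\<close>, then \<open>v\<close> exceeds the threshold, and \<open>e\<close> can only be rejected if it is spanned by
  the set \<open>S\<close> of the other elements of \<open>B\<close> above the threshold. Given \<open>S\<close>, the element \<open>e\<close> is uniform
  on \<open>B - S\<close>, and by uniform density \<open>S\<close> spans at most \<open>(\<bar>S\<bar> + 1) n / r\<close> elements, so the rejection
  probability given \<open>S\<close> is at most \<open>2 (\<bar>S\<bar> + 1) / r\<close>. A fixed \<open>f \<in> B - {e}\<close> is in \<open>S\<close> iff it is among
  the \<open>k + 1\<close> heaviest elements of \<open>insert f A\<close>, so \<open>\<bar>S\<bar>\<close> has mean at most \<open>k + 1\<close>. Hence \<open>v\<close> is
  collected with probability at least \<open>(1 - 2 (k + 2) / r) / 2\<close>, and the \<open>k + 1\<close> largest weights carry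
  at least a fraction \<open>(k + 1) / r\<close> of the total of the \<open>r\<close> largest ones.

  Rank below \<open>12\<close>: it suffices to select the maximum with probability \<open>11 / 40\<close>. The rule that skips
  the first half and then takes the first new maximum already achieves \<open>1 / 3\<close>.\<close>

section \<open>Exchange symmetry of random bijections\<close>

lemma sum_card_exchange:
  assumes "finite X" "finite Y"
  shows "(\<Sum>x\<in>X. card {y\<in>Y. P x y}) = (\<Sum>y\<in>Y. card {x\<in>X. P x y})"
proof -
  have "(\<Sum>x\<in>X. card {y\<in>Y. P x y}) = (\<Sum>x\<in>X. \<Sum>y\<in>Y. if P x y then 1 else 0)"
    by (simp add: sum.If_cases assms Int_def)
  also have "\<dots> = (\<Sum>y\<in>Y. \<Sum>x\<in>X. if P x y then 1 else 0)"
    by (rule sum.swap)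
  also have "\<dots> = (\<Sum>y\<in>Y. card {x\<in>X. P x y})"
    by (simp add: sum.If_cases assms Int_def)
  finally show ?thesis .
qed

text \<open>By injectivity, all counted elements except the \<open>f\<close>-least one lie strictly
  above that one, and at most \<open>k\<close> elements of \<open>D\<close> do.\<close>

lemma card_top_le:
  fixes f :: "'a \<Rightarrow> 'b::linorder"
  assumes "finite D" "inj_on f D"
  shows "card {g\<in>D. card {h\<in>D. f g < f h} \<le> k} \<le> k + 1"
proof (rule ccontr)
  let ?G = "{g\<in>D. card {h\<in>D. f g < f h} \<le> k}"
  assume "\<not> card ?G \<le> k + 1"
  then have big: "card ?G \<ge> k + 2" by simp
  have fin: "finite ?G" using assms by simp
  have ne: "?G \<noteq> {}" using big by (metis card.empty add_is_0 le_zero_eq zero_neq_numeral)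
  define m where "m = arg_min_on f ?G"
  have m: "m \<in> ?G" "\<And>g. g \<in> ?G \<Longrightarrow> f m \<le> f g"
    using arg_min_if_finite(1)[OF fin ne, of f] arg_min_least[OF fin ne, of _ f]
    unfolding m_def by blast+
  have "?G - {m} \<subseteq> {h\<in>D. f m < f h}"
    using m assms(2) by (auto simp: order.strict_iff_order inj_on_def)
  then have "card (?G - {m}) \<le> card {h\<in>D. f m < f h}"
    using assms(1) by (intro card_mono) auto
  moreover have "card (?G - {m}) = card ?G - 1" using m(1) fin by simp
  moreover have "card {h\<in>D. f m < f h} \<le> k" using m(1) by simp
  ultimately show False using big by linarith
qed

section \<open>Counting bijections from the ground set to the weights\<close>

lemma finite_bijections [simp]: "finite E \<Longrightarrow> finite W \<Longrightarrow> finite (bijections E W)"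
  unfolding bijections_def by (simp add: finite_PiE)

lemma bijections_nonempty:
  assumes "finite E" "finite W" "card E = card W"
  shows "bijections E W \<noteq> {}"
proof -
  obtain f where f: "bij_betw f E W"
    using finite_same_card_bij[OF assms] by blast
  have "restrict f E \<in> bijections E W"
    using f bij_betw_cong[of E f "restrict f E" W] by (auto simp: bijections_def bij_betw_def)
  then show ?thesis by blast
qed

lemma bijections_swap:
  assumes "\<omega> \<in> bijections E W" "a \<in> E" "b \<in> E"
  shows "\<omega> \<circ> Transposition.transpose a b \<in> bijections E W"
proof -
  have "bij_betw (Transposition.transpose a b) E E"
    using assms by (simp add: bij_betw_def)
  then have "bij_betw (\<omega> \<circ> Transposition.transpose a b) E W"
    using assms bij_betw_trans unfolding bijections_def by blast
  moreover have "(\<omega> \<circ> Transposition.transpose a b) x = undefined" if "x \<notin> E" for x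
  proof -
    have "Transposition.transpose a b x = x" using that assms(2,3) by (auto simp: Transposition.transpose_def)
    then show ?thesis using that assms(1) by (auto simp: bijections_def)
  qed
  ultimately show ?thesis
    unfolding bijections_def by (auto simp: PiE_def extensional_def bij_betw_def)
qed

text \<open>Precomposition with a transposition is an involution of \<open>bijections E W\<close>.
  This is the exchangeability of a uniformly random \<omega>, with probabilities expressed as ratios
  of counts.\<close>

lemma card_bijections_swap:
  assumes "a \<in> E" "b \<in> E"
  shows "card {\<omega>\<in>bijections E W. P (\<omega> \<circ> Transposition.transpose a b)} = card {\<omega>\<in>bijections E W. P \<omega>}"
proof (rule bij_betw_same_card)
  have tt: "(\<omega> \<circ> Transposition.transpose a b) \<circ> Transposition.transpose a b = \<omega>" for \<omega> :: "'a \<Rightarrow> real"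
    by (simp add: comp_assoc)
  show "bij_betw (\<lambda>\<omega>. \<omega> \<circ> Transposition.transpose a b)
      {\<omega>\<in>bijections E W. P (\<omega> \<circ> Transposition.transpose a b)} {\<omega>\<in>bijections E W. P \<omega>}"
    by (rule bij_betw_byWitness[where f' = "\<lambda>\<omega>. \<omega> \<circ> Transposition.transpose a b"])
       (use bijections_swap[OF _ assms] in \<open>auto simp del: o_apply simp: tt\<close>)
qed

lemma bijections_inj: "\<omega> \<in> bijections E W \<Longrightarrow> inj_on \<omega> E"
  by (simp add: bijections_def bij_betw_def)

lemma bijections_image: "\<omega> \<in> bijections E W \<Longrightarrow> \<omega> ` E = W"
  by (simp add: bijections_def bij_betw_def)

lemma card_bijections_preimage:
  assumes "\<omega> \<in> bijections E W" "v \<in> W"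
  shows "card {e\<in>E. \<omega> e = v} = 1"
proof -
  obtain e where "e \<in> E" "\<omega> e = v" using assms bijections_image by blast
  then have "{e\<in>E. \<omega> e = v} = {e}" using bijections_inj[OF assms(1)] by (auto simp: inj_on_def)
  then show ?thesis by simp
qed

text \<open>By symmetry the count is the same at every point of \<open>E\<close>, and summing over
  \<open>E\<close> counts each bijection once, at the unique preimage of \<open>v\<close>.\<close>

lemma card_bijections_point:
  assumes "finite E" "finite W" "e \<in> E" "v \<in> W"
  shows "card E * card {\<omega>\<in>bijections E W. \<omega> e = v} = card (bijections E W)"
proof -
  have "card {\<omega>\<in>bijections E W. \<omega> e' = v} = card {\<omega>\<in>bijections E W. \<omega> e = v}" if "e' \<in> E" for e'
    using card_bijections_swap[OF assms(3) that, of W "\<lambda>\<omega>. \<omega> e = v"] by simp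
  then have "card E * card {\<omega>\<in>bijections E W. \<omega> e = v} = (\<Sum>e'\<in>E. card {\<omega>\<in>bijections E W. \<omega> e' = v})"
    by simp
  also have "\<dots> = (\<Sum>\<omega>\<in>bijections E W. card {e'\<in>E. \<omega> e' = v})"
    by (rule sum_card_exchange) (use assms finite_bijections in auto)
  also have "\<dots> = card (bijections E W)"
    by (simp add: card_bijections_preimage[OF _ assms(4)] del: One_nat_def)
  finally show ?thesis .
qed

text \<open>Swapping two members of \<open>D\<close> fixes \<open>e\<close>, so the condition
  \<open>\<omega> e = v\<close> survives, while the number of heavier elements of \<open>D\<close>
  at one member becomes that at the other. Hence all members of \<open>D\<close> contribute equally
  to the double count.\<close>

lemma card_bijections_top:
  assumes "finite E" "finite W" "D \<subseteq> E" "d \<in> D" "e \<in> E - D"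
  shows "card D * card {\<omega>\<in>bijections E W. \<omega> e = v \<and> card {h\<in>D. \<omega> d < \<omega> h} \<le> k}
       = (\<Sum>\<omega>\<in>{\<omega>\<in>bijections E W. \<omega> e = v}. card {g\<in>D. card {h\<in>D. \<omega> g < \<omega> h} \<le> k})"
proof -
  let ?top = "\<lambda>\<omega> g. card {h\<in>D. \<omega> g < \<omega> h} \<le> k"
  have eq: "card {\<omega>\<in>bijections E W. \<omega> e = v \<and> ?top \<omega> g} = card {\<omega>\<in>bijections E W. \<omega> e = v \<and> ?top \<omega> d}"
    if "g \<in> D" for g
  proof -
    have tr: "card {h\<in>D. (\<omega> \<circ> Transposition.transpose d g) d < (\<omega> \<circ> Transposition.transpose d g) h}
        = card {h\<in>D. \<omega> g < \<omega> h}" for \<omega> :: "'a \<Rightarrow> real"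
      by (rule bij_betw_same_card[of "Transposition.transpose d g"], rule bij_betw_byWitness[of _ "Transposition.transpose d g"])
         (use assms that in \<open>auto simp: transpose_apply_commute Transposition.transpose_def split: if_splits\<close>)
    have "Transposition.transpose d g e = e"
      using that assms(4,5) by (auto simp: Transposition.transpose_def)
    then show ?thesis
      using card_bijections_swap[of d E g W "\<lambda>\<omega>. \<omega> e = v \<and> ?top \<omega> d"] assms(3,4) that
      unfolding tr by auto
  qed
  have "card D * card {\<omega>\<in>bijections E W. \<omega> e = v \<and> ?top \<omega> d}
      = (\<Sum>g\<in>D. card {\<omega>\<in>{\<omega>\<in>bijections E W. \<omega> e = v}. ?top \<omega> g})"
    using eq by simp
  also have "\<dots> = (\<Sum>\<omega>\<in>{\<omega>\<in>bijections E W. \<omega> e = v}. card {g\<in>D. ?top \<omega> g})"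
    by (rule sum_card_exchange) (simp_all add: finite_subset[OF assms(3,1)] assms)
  finally show ?thesis .
qed

text \<open>Each bijection has at most \<open>k + 1\<close> members of \<open>D\<close> on top by
  \<open>card_top_le\<close>, and the members of \<open>D\<close> share these places equally even
  when the position of \<open>v\<close> is known.\<close>

lemma card_bijections_top_le:
  assumes "finite E" "finite W" "D \<subseteq> E" "d \<in> D" "e \<in> E - D"
  shows "card D * card {\<omega>\<in>bijections E W. \<omega> e = v \<and> card {h\<in>D. \<omega> d < \<omega> h} \<le> k}
         \<le> (k + 1) * card {\<omega>\<in>bijections E W. \<omega> e = v}"
proof -
  have "card {g\<in>D. card {h\<in>D. \<omega> g < \<omega> h} \<le> k} \<le> k + 1" if "\<omega> \<in> bijections E W" for \<omega>
    using card_top_le[OF finite_subset[OF assms(3,1)]] inj_on_subset[OF bijections_inj[OF that] assms(3)] by blast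
  then have "(\<Sum>\<omega>\<in>{\<omega>\<in>bijections E W. \<omega> e = v}. card {g\<in>D. card {h\<in>D. \<omega> g < \<omega> h} \<le> k})
      \<le> (\<Sum>\<omega>\<in>{\<omega>\<in>bijections E W. \<omega> e = v}. k + 1)"
    by (intro sum_mono) simp
  then show ?thesis unfolding card_bijections_top[OF assms] by (simp add: mult.commute)
qed

text \<open>The case \<open>k = 0\<close> from below: every \<omega> attains a maximum on the
  nonempty \<open>D\<close>. In the secretary problem \<open>D\<close> consists of the items that
  precede the overall maximum.\<close>

lemma card_bijections_max_ge:
  assumes "finite E" "finite W" "D \<subseteq> E" "d \<in> D" "e \<in> E - D"
  shows "card {\<omega>\<in>bijections E W. \<omega> e = v}
         \<le> card D * card {\<omega>\<in>bijections E W. \<omega> e = v \<and> (\<forall>h\<in>D. \<omega> h \<le> \<omega> d)}"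
proof -
  have D: "finite D" "D \<noteq> {}" using assms finite_subset by auto
  have "1 \<le> card {g\<in>D. card {h\<in>D. \<omega> g < \<omega> h} \<le> 0}" for \<omega> :: "'a \<Rightarrow> real"
  proof -
    have "Max (\<omega> ` D) \<in> \<omega> ` D" using D by simp
    then obtain g where "g \<in> D" "\<omega> g = Max (\<omega> ` D)" by force
    then have "g \<in> {g\<in>D. card {h\<in>D. \<omega> g < \<omega> h} \<le> 0}" using D by (auto simp: not_less)
    then show ?thesis using D card_gt_0_iff[of "{g\<in>D. card {h\<in>D. \<omega> g < \<omega> h} \<le> 0}"]
      by (auto simp: Suc_le_eq)
  qed
  then have "(\<Sum>\<omega>\<in>{\<omega>\<in>bijections E W. \<omega> e = v}. 1)
      \<le> (\<Sum>\<omega>\<in>{\<omega>\<in>bijections E W. \<omega> e = v}. card {g\<in>D. card {h\<in>D. \<omega> g < \<omega> h} \<le> 0})"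
    by (intro sum_mono)
  moreover have "card {h\<in>D. \<omega> d < \<omega> h} \<le> 0 \<longleftrightarrow> (\<forall>h\<in>D. \<omega> h \<le> \<omega> d)" for \<omega> :: "'a \<Rightarrow> real"
    using D by (auto simp: not_less)
  ultimately show ?thesis using card_bijections_top[OF assms, of v 0] by simp
qed

section \<open>Matroid spans and the greedy rule\<close>

context matroid
begin

lemma finite_indep: "X \<in> I \<Longrightarrow> finite X"
  using finite_ground indep_subset_ground finite_subset by blast

lemma finite_indep_subsets: "finite {card X | X. X \<in> I \<and> X \<subseteq> S}"
proof (rule finite_subset)
  show "{card X | X. X \<in> I \<and> X \<subseteq> S} \<subseteq> card ` Pow E" using indep_subset_ground by auto
qed (use finite_ground in auto)

lemma card_le_rank: "X \<in> I \<Longrightarrow> X \<subseteq> S \<Longrightarrow> card X \<le> matroid_rank I S"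
  unfolding matroid_rank_def by (rule Max_ge[OF finite_indep_subsets]) auto

lemma obtain_basis:
  obtains X where "X \<in> I" "X \<subseteq> S" "card X = matroid_rank I S"
proof -
  have "matroid_rank I S \<in> {card X | X. X \<in> I \<and> X \<subseteq> S}"
    unfolding matroid_rank_def by (rule Max_in[OF finite_indep_subsets]) (use empty_indep in auto)
  then show ?thesis using that by auto
qed

lemma rank_le_card: "finite S \<Longrightarrow> matroid_rank I S \<le> card S"
  by (metis obtain_basis card_mono)

lemma extend_indep:
  assumes "X \<in> I" "Z \<in> I" "card X \<le> card Z"
  shows "\<exists>Y\<in>I. X \<subseteq> Y \<and> Y \<subseteq> X \<union> Z \<and> card Y = card Z"
  using assms
proof (induction "card Z - card X" arbitrary: X)
  case 0
  then show ?case by (intro bexI[of _ X]) auto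
next
  case (Suc m)
  then obtain z where z: "z \<in> Z - X" "insert z X \<in> I"
    using augmentation[of X Z] by (metis zero_less_diff zero_less_Suc)
  have c: "card (insert z X) = Suc (card X)" using z finite_indep Suc.prems by simp
  have m: "m = card Z - card (insert z X)" and le: "card (insert z X) \<le> card Z"
    using Suc.hyps(2) c by linarith+
  obtain Y where "Y \<in> I" "insert z X \<subseteq> Y" "Y \<subseteq> insert z X \<union> Z" "card Y = card Z"
    using Suc.hyps(1)[OF m z(2) Suc.prems(2) le] by blast
  then show ?case using z by (intro bexI[of _ Y]) auto
qed

end

text \<open>The closure of \<open>S\<close>, phrased through independent subsets of \<open>S\<close>
  instead of ranks so that it matches the test made by the greedy rule. The choice
  \<open>X = {}\<close> puts every loop into it.\<close>

definition matroid_span :: "'a set \<Rightarrow> 'a set set \<Rightarrow> 'a set \<Rightarrow> 'a set" where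
  "matroid_span E I S = {e\<in>E. e \<in> S \<or> (\<exists>X\<in>I. X \<subseteq> S \<and> insert e X \<notin> I)}"

context matroid
begin

text \<open>An independent set in the span with more than \<open>card S\<close> elements would
  extend a basis \<open>B\<close> of \<open>S\<close> by some \<open>y\<close> outside
  \<open>S\<close>. Being spanned, \<open>y\<close> makes some independent
  \<open>X \<subseteq> S\<close> dependent. Extending \<open>X\<close> inside
  \<open>X \<union> insert y B\<close> to size \<open>card B + 1\<close> must then avoid
  \<open>y\<close>, which gives an independent subset of \<open>S\<close> larger than
  \<open>B\<close>.\<close>

lemma rank_span_le:
  assumes "finite S"
  shows "matroid_rank I (matroid_span E I S) \<le> card S"
proof (rule ccontr)
  assume less: "\<not> ?thesis"
  obtain Y where Y: "Y \<in> I" "Y \<subseteq> matroid_span E I S" "card Y = matroid_rank I (matroid_span E I S)"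
    by (rule obtain_basis)
  obtain B where B: "B \<in> I" "B \<subseteq> S" "card B = matroid_rank I S" by (rule obtain_basis)
  have "card B < card Y" using less Y B rank_le_card[OF assms] by simp
  then obtain y where y: "y \<in> Y - B" "insert y B \<in> I" using augmentation Y B by blast
  have c: "card (insert y B) = Suc (matroid_rank I S)" using y B finite_indep by simp
  have "y \<notin> S" using card_le_rank[OF y(2), of S] c B by auto
  then obtain X where X: "X \<in> I" "X \<subseteq> S" "insert y X \<notin> I"
    using y Y by (auto simp: matroid_span_def)
  obtain Z where Z: "Z \<in> I" "X \<subseteq> Z" "Z \<subseteq> X \<union> insert y B" "card Z = Suc (matroid_rank I S)"
    using extend_indep[OF X(1) y(2)] card_le_rank[OF X(1,2)] c by auto
  have "y \<notin> Z" using X(3) Z indep_subset by (metis insert_subset)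
  then have "Z \<subseteq> S" using Z X B by auto
  then show False using card_le_rank[OF Z(1), of S] Z(4) by simp
qed

text \<open>Adding a non-loop to the span makes the density bound applicable even when \<open>S\<close> has rank \<open>0\<close>.\<close>

lemma card_span_le:
  assumes "uniformly_dense E I" "0 < matroid_rank I E" "finite S"
  shows "real (card (matroid_span E I S)) \<le> real (card S + 1) * (real (card E) / real (matroid_rank I E))"
proof -
  obtain B where B: "B \<in> I" "card B = matroid_rank I E" by (rule obtain_basis)
  then obtain x where x: "x \<in> B" using assms(2) by fastforce
  have xI: "{x} \<in> I" using indep_subset[OF B(1)] x by simp
  let ?F = "insert x (matroid_span E I S)"
  have sub: "?F \<subseteq> E" using xI indep_subset_ground by (auto simp: matroid_span_def)
  obtain Y where Y: "Y \<in> I" "Y \<subseteq> ?F" "card Y = matroid_rank I ?F" by (rule obtain_basis)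
  \<comment> \<open>Removing \<open>x\<close> from a basis of \<open>?F\<close> leaves an
    independent subset of the span, so \<open>x\<close> raises the rank by at most one.\<close>
  have "card (Y - {x}) \<le> matroid_rank I (matroid_span E I S)"
    by (rule card_le_rank[OF indep_subset[OF Y(1)]]) (use Y(2) in auto)
  also have "\<dots> \<le> card S"
    by (rule rank_span_le[OF assms(3)])
  finally have "card (Y - {x}) \<le> card S" .
  then have rk: "matroid_rank I ?F \<le> card S + 1"
    using Y(3) card_Diff_singleton[of x Y] by (cases "x \<in> Y") auto
  have pos: "0 < matroid_rank I ?F" using card_le_rank[OF xI, of ?F] by simp
  have "real (card (matroid_span E I S)) \<le> real (card ?F)"
    using sub finite_ground finite_subset card_mono[of ?F "matroid_span E I S"] by (metis of_nat_le_iff subset_insertI)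
  also have "real (card ?F) \<le> real (matroid_rank I ?F) * (real (card E) / real (matroid_rank I E))"
  proof -
    have "real (card ?F) / real (matroid_rank I ?F) \<le> real (card E) / real (matroid_rank I E)"
      using assms(1) sub pos unfolding uniformly_dense_def by blast
    then show ?thesis using pos by (simp add: divide_le_eq mult.commute)
  qed
  also have "\<dots> \<le> real (card S + 1) * (real (card E) / real (matroid_rank I E))"
    using rk by (intro mult_right_mono) auto
  finally show ?thesis .
qed

end

section \<open>The greedy rule above a fixed threshold\<close>

lemma greedy_above_snoc:
  "greedy_above I c \<omega> (es @ [e]) =
     (if c < \<omega> e \<and> insert e (greedy_above I c \<omega> es) \<in> I then insert e (greedy_above I c \<omega> es)
      else greedy_above I c \<omega> es)"
  by (simp add: greedy_above_def)

lemma greedy_above_subset: "greedy_above I c \<omega> es \<subseteq> {f\<in>set es. c < \<omega> f}"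
  by (induction es rule: rev_induct) (auto simp: greedy_above_snoc, simp add: greedy_above_def)

lemma greedy_above_append_subset: "greedy_above I c \<omega> xs \<subseteq> greedy_above I c \<omega> (xs @ ys)"
  by (induction ys rule: rev_induct) (auto simp: greedy_above_snoc simp flip: append_assoc)

lemma (in matroid) greedy_above_indep: "greedy_above I c \<omega> es \<in> I"
  by (induction es rule: rev_induct) (auto simp: greedy_above_snoc, simp add: greedy_above_def empty_indep)

text \<open>When \<open>e\<close> arrives, the accepted set is an independent set of other elements
  above the threshold. If it blocked \<open>e\<close>, it would witness that \<open>e\<close> is
  spanned. Later arrivals never remove \<open>e\<close>.\<close>

lemma (in matroid) mem_greedy_above:
  assumes "distinct es" "e \<in> set es" "e \<in> E" "c < \<omega> e"
    and "e \<notin> matroid_span E I {f\<in>set es. c < \<omega> f \<and> f \<noteq> e}"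
  shows "e \<in> greedy_above I c \<omega> es"
proof -
  obtain xs ys where es: "es = xs @ e # ys" by (meson assms(2) split_list)
  let ?X = "greedy_above I c \<omega> xs"
  have "?X \<subseteq> {f\<in>set es. c < \<omega> f \<and> f \<noteq> e}"
    using greedy_above_subset[of I c \<omega> xs] assms(1) es by auto
  then have "insert e ?X \<in> I"
    using assms(3,5) greedy_above_indep unfolding matroid_span_def by blast
  then have "e \<in> greedy_above I c \<omega> (xs @ [e])" using assms(4) by (simp add: greedy_above_snoc)
  then show ?thesis
    using greedy_above_append_subset[of I c \<omega> "xs @ [e]" ys] es by auto
qed

section \<open>Sampling a threshold\<close>

text \<open>In the decreasing rearrangement the threshold has index \<open>k\<close>, so it lies
  below \<open>x\<close> iff the entries above \<open>x\<close> occupy only indices less than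
  \<open>k\<close>. The assumption \<open>x \<notin> set xs\<close> excludes a tie with the
  threshold.\<close>

lemma kth_largest_less_iff:
  assumes "distinct xs" "k < length xs" "x \<notin> set xs"
  shows "kth_largest (k + 1) xs < x \<longleftrightarrow> card {u\<in>set xs. x < u} \<le> k"
proof -
  define ys where "ys = rev (sort xs)"
  have ys: "distinct ys" "set ys = set xs" "length ys = length xs"
    using assms by (auto simp: ys_def)
  have dec: "ys ! j \<le> ys ! i" if "i \<le> j" "j < length ys" for i j
    using that sorted_rev_nth_mono[of ys i j] by (simp add: ys_def)
  have card: "card {u\<in>set xs. x < u} = card {i. i < length ys \<and> x < ys ! i}"
  proof -
    have "{u\<in>set xs. x < u} = (\<lambda>i. ys ! i) ` {i. i < length ys \<and> x < ys ! i}"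
      unfolding ys(2)[symmetric] by (auto simp: in_set_conv_nth)
    moreover have "inj_on (\<lambda>i. ys ! i) {i. i < length ys \<and> x < ys ! i}"
      using ys(1) by (simp add: inj_on_def nth_eq_iff_index_eq)
    ultimately show ?thesis by (simp add: card_image)
  qed
  show ?thesis
  proof
    assume "kth_largest (k + 1) xs < x"
    then have lt: "ys ! k < x" by (simp add: kth_largest_def ys_def)
    have "i < k" if "i < length ys" "x < ys ! i" for i
    proof (rule ccontr)
      assume "\<not> i < k"
      with dec[of k i] that lt show False by simp
    qed
    then have "{i. i < length ys \<and> x < ys ! i} \<subseteq> {..<k}" by auto
    then show "card {u\<in>set xs. x < u} \<le> k" using card card_mono[of "{..<k}"] by simp
  next
    assume le: "card {u\<in>set xs. x < u} \<le> k"
    show "kth_largest (k + 1) xs < x"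
    proof (rule ccontr)
      assume "\<not> kth_largest (k + 1) xs < x"
      then have "x \<le> ys ! k" by (simp add: kth_largest_def ys_def)
      moreover have "ys ! k \<in> set xs" using assms(2) ys by (metis nth_mem)
      ultimately have gt: "x < ys ! k" using assms(3) by (metis order.not_eq_order_implies_strict)
      have "x < ys ! i" if "i \<le> k" for i
        using dec[of i k] that gt assms(2) ys(3) by simp
      then have "{..k} \<subseteq> {i. i < length ys \<and> x < ys ! i}" using assms(2) ys(3) by auto
      then have "k + 1 \<le> card {i. i < length ys \<and> x < ys ! i}"
        using card_mono[of "{i. i < length ys \<and> x < ys ! i}" "{..k}"] by simp
      with le card show False by simp
    qed
  qed
qed

text \<open>Given \<open>\<omega> e = v\<close>, every other \<open>f \<in> B\<close> is counted
  with probability at most \<open>(k + 1) / (card A + 1)\<close>, and there are at most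
  \<open>card A\<close> such \<open>f\<close>. The bound on \<open>card B\<close> allows for the
  extra element in the second half of a list of odd length.\<close>

lemma sum_card_sampled_le:
  assumes "finite E" "finite W" "E = A \<union> B" "A \<inter> B = {}" "card B \<le> card A + 1" "e \<in> B"
  shows "(\<Sum>\<omega>\<in>{\<omega>\<in>bijections E W. \<omega> e = v}. card {f\<in>B. \<omega> f \<noteq> v \<and> card {h\<in>A. \<omega> f < \<omega> h} \<le> k})
         \<le> (k + 1) * card {\<omega>\<in>bijections E W. \<omega> e = v}"
proof -
  let ?O = "{\<omega>\<in>bijections E W. \<omega> e = v}"
  let ?P = "\<lambda>\<omega> f. \<omega> f \<noteq> v \<and> card {h\<in>A. \<omega> f < \<omega> h} \<le> k"
  have fin: "finite ?O" "finite A" "finite B"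
    using finite_bijections[OF assms(1,2)] assms(1) by (simp_all add: assms(3))
  have each: "(card A + 1) * card {\<omega>\<in>?O. ?P \<omega> f} \<le> (k + 1) * card ?O" if "f \<in> B - {e}" for f
  proof -
    have f: "f \<notin> A" using that assms(4) by auto
    \<comment> \<open>Adding \<open>f\<close> to \<open>A\<close> does not change the number of
      heavier elements, but makes \<open>f\<close> exchangeable with the members of
      \<open>A\<close>.\<close>
    have "{h\<in>insert f A. \<omega> f < \<omega> h} = {h\<in>A. \<omega> f < \<omega> h}" for \<omega> :: "'a \<Rightarrow> real" by auto
    then have "{\<omega>\<in>?O. ?P \<omega> f} \<subseteq> {\<omega>\<in>bijections E W. \<omega> e = v \<and> card {h\<in>insert f A. \<omega> f < \<omega> h} \<le> k}"
      by auto
    then have "card {\<omega>\<in>?O. ?P \<omega> f}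
        \<le> card {\<omega>\<in>bijections E W. \<omega> e = v \<and> card {h\<in>insert f A. \<omega> f < \<omega> h} \<le> k}"
      using assms(1,2) by (intro card_mono) simp_all
    then have "(card A + 1) * card {\<omega>\<in>?O. ?P \<omega> f} \<le> card (insert f A) *
        card {\<omega>\<in>bijections E W. \<omega> e = v \<and> card {h\<in>insert f A. \<omega> f < \<omega> h} \<le> k}"
      unfolding card_insert_disjoint[OF fin(2) f] Suc_eq_plus1 by (rule mult_le_mono2)
    also have "\<dots> \<le> (k + 1) * card ?O"
      using that assms(3,4,6) by (intro card_bijections_top_le assms(1,2)) auto
    finally show ?thesis .
  qed
  have e0: "card {\<omega>\<in>?O. ?P \<omega> e} = 0"
    by (rule card_eq_0_iff[THEN iffD2]) auto
  have "(\<Sum>\<omega>\<in>?O. card {f\<in>B. ?P \<omega> f}) = (\<Sum>f\<in>B. card {\<omega>\<in>?O. ?P \<omega> f})"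
    by (rule sum_card_exchange) (use fin in auto)
  also have "\<dots> = (\<Sum>f\<in>B - {e}. card {\<omega>\<in>?O. ?P \<omega> f})"
    by (subst sum.remove[OF fin(3) assms(6)], subst e0) simp
  finally have eq: "(\<Sum>\<omega>\<in>?O. card {f\<in>B. ?P \<omega> f}) = \<dots>" .
  have "(card A + 1) * (\<Sum>\<omega>\<in>?O. card {f\<in>B. ?P \<omega> f}) \<le> (\<Sum>f\<in>B - {e}. (k + 1) * card ?O)"
    unfolding eq sum_distrib_left by (rule sum_mono) (use each in auto)
  also have "\<dots> = card (B - {e}) * ((k + 1) * card ?O)"
    by simp
  also have "\<dots> \<le> (card A + 1) * ((k + 1) * card ?O)"
    using assms(5,6) fin(3) by (intro mult_le_mono1) simp
  finally show ?thesis by (simp only: mult_le_cancel1)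
qed

text \<open>Exchanging the position \<open>e\<close> of \<open>v\<close> with any \<open>f \<in> B - S \<omega>\<close> does not change \<open>S \<omega>\<close>, so
  given \<open>S \<omega>\<close> the position of \<open>v\<close> is uniform on \<open>B - S \<omega>\<close>.\<close>

lemma sum_hit_le:
  fixes F :: "'a set \<Rightarrow> 'a set" and v :: real and k :: nat
  assumes "finite E" "finite W" "E = A \<union> B" "A \<inter> B = {}"
    and F: "\<And>T. T \<subseteq> B \<Longrightarrow> T \<subseteq> F T" "\<And>T. finite (F T)"
  defines "S \<equiv> \<lambda>\<omega>. {f\<in>B. \<omega> f \<noteq> v \<and> card {h\<in>A. \<omega> f < \<omega> h} \<le> k}"
    and "X \<equiv> {(\<omega>, e). \<omega> \<in> bijections E W \<and> e \<in> B \<and> \<omega> e = v}"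
  shows "(\<Sum>(\<omega>, e)\<in>X. of_bool (e \<in> F (S \<omega>))) \<le> (\<Sum>(\<omega>, e)\<in>X. real (card (F (S \<omega>))) / real (card B))"
proof -
  have finB: "finite B" using assms by auto
  have SB: "S \<omega> \<subseteq> B" for \<omega> by (auto simp: S_def)
  have finS: "finite (S \<omega>)" for \<omega> using SB finB finite_subset by blast
  have "X \<subseteq> bijections E W \<times> B" by (auto simp: X_def)
  then have finX: "finite X"
    using finB finite_bijections[OF assms(1,2)] by (meson finite_SigmaI finite_subset)
  let ?D = "\<lambda>\<omega>. real (card (B - S \<omega>))"
  have inX: "e \<in> B - S \<omega>" if "(\<omega>, e) \<in> X" for \<omega> e using that by (auto simp: X_def S_def)
  have pos: "?D \<omega> > 0" if "(\<omega>, e) \<in> X" for \<omega> e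
    using inX[OF that] finB by (auto simp: card_gt_0_iff)
  have swap: "(\<omega> \<circ> Transposition.transpose e f, f) \<in> X" "S (\<omega> \<circ> Transposition.transpose e f) = S \<omega>"
    "(\<omega> \<circ> Transposition.transpose e f) \<circ> Transposition.transpose f e = \<omega>"
    if "(\<omega>, e) \<in> X" "f \<in> B - S \<omega>" for \<omega> e f
  proof -
    let ?w = "\<omega> \<circ> Transposition.transpose e f"
    have e: "e \<in> B" "\<omega> e = v" "\<omega> \<in> bijections E W" using that(1) by (auto simp: X_def)
    show "(?w, f) \<in> X" using e that bijections_swap[of \<omega> E W e f] assms(3) by (auto simp: X_def)
    have A: "?w h = \<omega> h" if "h \<in> A" for h
      using that e \<open>f \<in> B - S \<omega>\<close> assms(4) by (auto simp: Transposition.transpose_def)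
    have "{h\<in>A. ?w g < ?w h} = {h\<in>A. ?w g < \<omega> h}" for g using A by auto
    then show "S ?w = S \<omega>"
      using e that(2) by (auto simp: S_def Transposition.transpose_def)
    show "?w \<circ> Transposition.transpose f e = \<omega>"
      by (simp add: comp_assoc transpose_commute[of f e])
  qed
  \<comment> \<open>Each indicator is spread evenly over the positions
    \<open>f \<in> B - S \<omega>\<close>, of which \<open>e\<close> itself is one.\<close>
  have "(\<Sum>(\<omega>, e)\<in>X. of_bool (e \<in> F (S \<omega>)))
      = (\<Sum>(\<omega>, e)\<in>X. \<Sum>f\<in>B - S \<omega>. of_bool (e \<in> F (S \<omega>)) / ?D \<omega>)"
    by (rule sum.cong[OF refl]) (use pos in force)
  also have "\<dots> = (\<Sum>((\<omega>, e), f)\<in>(SIGMA p:X. B - S (fst p)). of_bool (e \<in> F (S \<omega>)) / ?D \<omega>)"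
    using finX finB by (subst sum.Sigma[symmetric]) (auto simp: case_prod_beta)
  \<comment> \<open>Moving \<open>v\<close> from \<open>e\<close> to \<open>f\<close> while
    remembering \<open>e\<close> is an involution that preserves \<open>S \<omega>\<close>, so it
    trades the indicator of \<open>e\<close> for that of \<open>f\<close>.\<close>
  also have "\<dots> = (\<Sum>((\<omega>, e), f)\<in>(SIGMA p:X. B - S (fst p)). of_bool (f \<in> F (S \<omega>)) / ?D \<omega>)"
    by (rule sum.reindex_bij_witness[where
          i = "\<lambda>((\<omega>, e), f). ((\<omega> \<circ> Transposition.transpose e f, f), e)" and
          j = "\<lambda>((\<omega>, e), f). ((\<omega> \<circ> Transposition.transpose e f, f), e)"])
       (use swap inX in \<open>auto simp del: o_apply\<close>)
  also have "\<dots> = (\<Sum>(\<omega>, e)\<in>X. \<Sum>f\<in>B - S \<omega>. of_bool (f \<in> F (S \<omega>)) / ?D \<omega>)"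
    using finX finB by (subst sum.Sigma[symmetric]) (auto simp: case_prod_beta)
  also have "\<dots> \<le> (\<Sum>(\<omega>, e)\<in>X. real (card (F (S \<omega>))) / real (card B))"
  proof (rule sum_mono, clarify)
    fix \<omega> e assume X: "(\<omega>, e) \<in> X"
    let ?C = "F (S \<omega>) \<inter> B"
    have sub: "S \<omega> \<subseteq> ?C" using F(1) SB by blast
    have "(\<Sum>f\<in>B - S \<omega>. of_bool (f \<in> F (S \<omega>)) / ?D \<omega>) = real (card ((B - S \<omega>) \<inter> {f. f \<in> F (S \<omega>)})) / ?D \<omega>"
      using finB by (simp flip: sum_divide_distrib)
    also have "(B - S \<omega>) \<inter> {f. f \<in> F (S \<omega>)} = ?C - S \<omega>" by auto
    also have "real (card (?C - S \<omega>)) / ?D \<omega> = (real (card ?C) - real (card (S \<omega>))) / (real (card B) - real (card (S \<omega>)))"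
      using sub SB[of \<omega>] finS[of \<omega>] finB card_mono[of ?C "S \<omega>"] card_mono[OF finB SB[of \<omega>]]
      by (simp add: card_Diff_subset of_nat_diff)
    \<comment> \<open>A fraction at most 1 does not grow when the same amount is subtracted from
      numerator and denominator, as long as the denominator stays positive.\<close>
    also have "\<dots> \<le> real (card ?C) / real (card B)"
    proof -
      have "card (S \<omega>) < card B"
        using inX[OF X] SB[of \<omega>] finB by (metis Diff_iff psubset_card_mono psubsetI)
      moreover have "card ?C \<le> card B" using finB by (intro card_mono) auto
      ultimately have "real (card (S \<omega>)) * real (card ?C) \<le> real (card (S \<omega>)) * real (card B)" "real (card B) > real (card (S \<omega>))"
        by (auto intro: mult_left_mono)
      then show ?thesis by (simp add: divide_simps algebra_simps)
    qed
    also have "\<dots> \<le> real (card (F (S \<omega>))) / real (card B)"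
      using F(2) by (intro divide_right_mono) (auto intro: card_mono)
    finally show "(\<Sum>f\<in>B - S \<omega>. of_bool (f \<in> F (S \<omega>)) / ?D \<omega>) \<le> real (card (F (S \<omega>))) / real (card B)" .
  qed
  finally show ?thesis .
qed

text \<open>\<open>X\<close> collects the cases where \<open>v\<close> falls on some
  \<open>e \<in> B\<close>, and \<open>X0\<close> those where this \<open>e\<close> is moreover
  spanned. \<open>X\<close> has at least half the size of \<open>bijections E W\<close> because
  \<open>card A \<le> card B\<close>. Chaining \<open>sum_hit_le\<close>,
  \<open>card_span_le\<close> and \<open>sum_card_sampled_le\<close> bounds \<open>X0\<close> by the
  fraction \<open>2 * (k + 2) / r\<close> of \<open>X\<close>.\<close>

lemma (in matroid) card_not_spanned_ge:
  assumes "finite W" "E = A \<union> B" "A \<inter> B = {}" "card A \<le> card B" "card B \<le> card A + 1" "v \<in> W"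
    and "uniformly_dense E I" "matroid_rank I E = r" "0 < r"
    and "card E = card W" "2 * (k + 2) \<le> r"
  shows "(1 - 2 * (real k + 2) / real r) / 2 * real (card (bijections E W))
    \<le> real (card {\<omega>\<in>bijections E W. \<exists>e\<in>B. \<omega> e = v \<and>
           e \<notin> matroid_span E I {f\<in>B. \<omega> f \<noteq> v \<and> card {h\<in>A. \<omega> f < \<omega> h} \<le> k}})"
    (is "_ \<le> real (card ?G)")
proof -
  define S where "S = (\<lambda>\<omega> :: 'a \<Rightarrow> real. {f\<in>B. \<omega> f \<noteq> v \<and> card {h\<in>A. \<omega> f < \<omega> h} \<le> k})"
  define X where "X = {(\<omega>, e). \<omega> \<in> bijections E W \<and> e \<in> B \<and> \<omega> e = v}"
  define F where "F = matroid_span E I"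
  define \<Omega> where "\<Omega> = (\<lambda>e. {\<omega>\<in>bijections E W. \<omega> e = v})"
  define X0 where "X0 = {p\<in>X. snd p \<in> F (S (fst p))}"
  have finB: "finite B" and BE: "B \<subseteq> E" using assms(2) finite_ground by auto
  have finO: "finite (\<Omega> e)" for e
    using finite_bijections[OF finite_ground assms(1)] by (simp add: \<Omega>_def)
  have sumX: "(\<Sum>(\<omega>, e)\<in>X. g \<omega> e) = (\<Sum>e\<in>B. \<Sum>\<omega>\<in>\<Omega> e. g \<omega> e)" for g :: "('a \<Rightarrow> real) \<Rightarrow> 'a \<Rightarrow> real"
  proof -
    have "(\<Sum>e\<in>B. \<Sum>\<omega>\<in>\<Omega> e. g \<omega> e) = (\<Sum>(e, \<omega>)\<in>Sigma B \<Omega>. g \<omega> e)"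
      using finB finO by (subst sum.Sigma) auto
    also have "\<dots> = (\<Sum>(\<omega>, e)\<in>X. g \<omega> e)"
      by (rule sum.reindex_bij_witness[where i = prod.swap and j = prod.swap]) (auto simp: X_def \<Omega>_def)
    finally show ?thesis by simp
  qed
  have "X \<subseteq> bijections E W \<times> B" by (auto simp: X_def)
  then have finX: "finite X"
    using finB finite_bijections[OF finite_ground assms(1)] by (meson finite_SigmaI finite_subset)
  have n: "real (card E) * real (card (\<Omega> e)) = real (card (bijections E W))" if "e \<in> B" for e
    unfolding \<Omega>_def of_nat_mult[symmetric]
    using card_bijections_point[OF finite_ground assms(1) subsetD[OF BE that] assms(6)] by simp
  have cX: "real (card X) = (\<Sum>e\<in>B. real (card (\<Omega> e)))" using sumX[of "\<lambda>_ _. 1"] by (simp add: case_prod_beta)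
  then have EX: "real (card E) * real (card X) = real (card B) * real (card (bijections E W))"
    using n by (simp add: sum_distrib_left)
  have cE: "card E = card A + card B"
    using assms(2,3) finite_ground by (auto simp: card_Un_disjoint)
  have "real (card E) * (real (card (bijections E W)) / 2) \<le> real (card E) * real (card X)"
    using mult_right_mono[of "real (card E)" "2 * real (card B)" "real (card (bijections E W))"]
      cE assms(4) unfolding EX by simp
  moreover have "0 < real (card E)"
    using assms(1,6,10) by (auto simp: card_gt_0_iff)
  ultimately have X: "real (card (bijections E W)) / 2 \<le> real (card X)"
    using mult_le_cancel_left_pos by blast
  have "real (card X0) = (\<Sum>(\<omega>, e)\<in>X. of_bool (e \<in> F (S \<omega>)))"
    using finX by (simp add: X0_def case_prod_beta Int_def)
  also have "\<dots> \<le> (\<Sum>(\<omega>, e)\<in>X. real (card (F (S \<omega>))) / real (card B))"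
    unfolding X_def S_def F_def
    by (rule sum_hit_le[OF finite_ground assms(1-3)])
       (use BE finite_ground in \<open>auto simp: matroid_span_def\<close>)
  also have "\<dots> \<le> (\<Sum>(\<omega>, e)\<in>X. 2 / real r * (real (card (S \<omega>)) + 1))"
  proof (rule sum_mono, clarify)
    fix \<omega> e assume "(\<omega>, e) \<in> X"
    then have "card B > 0" using finB by (auto simp: X_def card_gt_0_iff)
    have "finite (S \<omega>)" using finB by (simp add: S_def)
    from card_span_le[OF assms(7) _ this]
    have "real (card (F (S \<omega>))) \<le> (real (card (S \<omega>)) + 1) * (real (card E) / real r)"
      using assms(8,9) by (simp add: F_def add.commute)
    \<comment> \<open>The factor 2 comes from \<open>card E \<le> 2 * card B\<close>, which makes
      the density bound relative to \<open>B\<close>.\<close>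
    also have "\<dots> \<le> (real (card (S \<omega>)) + 1) * (2 * real (card B) / real r)"
      using cE assms(4) by (intro mult_left_mono divide_right_mono) auto
    finally show "real (card (F (S \<omega>))) / real (card B) \<le> 2 / real r * (real (card (S \<omega>)) + 1)"
      using \<open>card B > 0\<close> assms(9) by (simp add: field_simps)
  qed
  also have "\<dots> = (\<Sum>e\<in>B. 2 / real r * (real (\<Sum>\<omega>\<in>\<Omega> e. card (S \<omega>)) + real (card (\<Omega> e))))"
    by (simp only: sumX of_nat_sum sum.distrib sum_constant mult_1_right flip: sum_distrib_left)
  also have "\<dots> \<le> (\<Sum>e\<in>B. 2 / real r * (real k + 2) * real (card (\<Omega> e)))"
  proof (rule sum_mono)
    fix e assume "e \<in> B"
    then have "(\<Sum>\<omega>\<in>\<Omega> e. card (S \<omega>)) \<le> (k + 1) * card (\<Omega> e)"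
      unfolding \<Omega>_def S_def by (intro sum_card_sampled_le[OF finite_ground assms(1-3,5)])
    then have "real (\<Sum>\<omega>\<in>\<Omega> e. card (S \<omega>)) \<le> real ((k + 1) * card (\<Omega> e))"
      by (simp only: of_nat_le_iff)
    then have "2 / real r * (real (\<Sum>\<omega>\<in>\<Omega> e. card (S \<omega>)) + real (card (\<Omega> e)))
        \<le> 2 / real r * ((real k + 2) * real (card (\<Omega> e)))"
      by (intro mult_left_mono) (simp_all add: algebra_simps)
    then show "2 / real r * (real (\<Sum>\<omega>\<in>\<Omega> e. card (S \<omega>)) + real (card (\<Omega> e)))
        \<le> 2 / real r * (real k + 2) * real (card (\<Omega> e))" by (simp only: mult.assoc)
  qed
  also have "\<dots> = 2 / real r * (real k + 2) * real (card X)"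
    using cX by (simp add: sum_distrib_left)
  finally have X0: "real (card X0) \<le> 2 / real r * (real k + 2) * real (card X)" .
  have "card (X - X0) \<le> card ?G"
  proof (rule card_inj_on_le[of fst])
    have "e = e'" if "(\<omega>, e) \<in> X" "(\<omega>, e') \<in> X" for \<omega> e e'
      using that BE inj_onD[OF bijections_inj[of \<omega> E W], of e e'] by (auto simp: X_def)
    then show "inj_on fst (X - X0)" by (auto simp: inj_on_def)
    show "fst ` (X - X0) \<subseteq> ?G" by (auto simp: X0_def X_def S_def F_def)
    show "finite ?G" using finite_bijections[OF finite_ground assms(1)] by simp
  qed
  moreover have "card (X - X0) = card X - card X0" "card X0 \<le> card X"
    using finX by (auto simp: X0_def intro!: card_Diff_subset card_mono finite_subset[OF _ finX])
  ultimately have "real (card X) - real (card X0) \<le> real (card ?G)" by simp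
  moreover have "(1 - 2 * (real k + 2) / real r) / 2 * real (card (bijections E W))
      \<le> (1 - 2 * (real k + 2) / real r) * real (card X)"
  proof -
    \<comment> \<open>The sign matters because the lower bound on \<open>card X\<close> is
      multiplied by this factor.\<close>
    have "0 \<le> 1 - 2 * (real k + 2) / real r" using assms(9,11) by (simp add: divide_le_eq)
    then show ?thesis using mult_left_mono[OF X] by fastforce
  qed
  moreover have "(1 - 2 * (real k + 2) / real r) * real (card X)
      = real (card X) - 2 / real r * (real k + 2) * real (card X)"
    by (simp add: left_diff_distrib)
  ultimately show ?thesis using X0 by linarith
qed

text \<open>Linearity of expectation, taken over weights instead of elements. As \<omega> is
  injective on \<open>R \<omega>\<close>, the collected value is the sum of the weights hit, and
  ignoring those outside \<open>V\<close> only lowers it since weights are nonnegative.\<close>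

lemma bijections_expectation_ge:
  assumes "finite E" "finite W" "card E = card W" "\<And>u. u \<in> W \<Longrightarrow> 0 \<le> u"
    and "\<And>\<omega>. \<omega> \<in> bijections E W \<Longrightarrow> R \<omega> \<subseteq> E"
    and "V \<subseteq> W" "\<And>v. v \<in> V \<Longrightarrow> c * real (card (bijections E W)) \<le> real (card {\<omega>\<in>bijections E W. v \<in> \<omega> ` R \<omega>})"
  shows "c * \<Sum>V \<le> measure_pmf.expectation (pmf_of_set (bijections E W)) (\<lambda>\<omega>. \<Sum>e\<in>R \<omega>. \<omega> e)"
proof -
  let ?B = "bijections E W"
  have fin: "finite ?B" and ne: "?B \<noteq> {}" using assms bijections_nonempty by simp_all
  have finV: "finite V" using assms(2,6) finite_subset by blast
  have "real (card ?B) * (c * \<Sum>V) = (\<Sum>v\<in>V. v * (c * real (card ?B)))"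
    by (simp add: sum_distrib_left mult_ac)
  also have "\<dots> \<le> (\<Sum>v\<in>V. v * real (card {\<omega>\<in>?B. v \<in> \<omega> ` R \<omega>}))"
    using assms(4,6,7) by (intro sum_mono mult_left_mono) auto
  also have "\<dots> = (\<Sum>v\<in>V. \<Sum>\<omega>\<in>?B. v * of_bool (v \<in> \<omega> ` R \<omega>))"
    using fin by (simp add: Int_def flip: sum_distrib_left)
  also have "\<dots> = (\<Sum>\<omega>\<in>?B. \<Sum>v\<in>V. v * of_bool (v \<in> \<omega> ` R \<omega>))"
    by (rule sum.swap)
  also have "\<dots> \<le> (\<Sum>\<omega>\<in>?B. \<Sum>e\<in>R \<omega>. \<omega> e)"
  proof (rule sum_mono)
    fix \<omega> assume w: "\<omega> \<in> ?B"
    have R: "finite (R \<omega>)" "R \<omega> \<subseteq> E" using assms(5)[OF w] finite_subset[OF _ assms(1)] by auto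
    have sub: "\<omega> ` R \<omega> \<subseteq> W" using R(2) bijections_image[OF w] by blast
    have "(\<Sum>v\<in>V. v * of_bool (v \<in> \<omega> ` R \<omega>)) = \<Sum>(V \<inter> \<omega> ` R \<omega>)"
      using finV by (simp add: of_bool_def sum.inter_restrict if_distrib cong: if_cong)
    also have "\<dots> \<le> \<Sum>(\<omega> ` R \<omega>)"
      using R sub assms(4) by (intro sum_mono2) auto
    also have "\<dots> = (\<Sum>e\<in>R \<omega>. \<omega> e)"
      using inj_on_subset[OF bijections_inj[OF w] R(2)] by (simp add: sum.reindex)
    finally show "(\<Sum>v\<in>V. v * of_bool (v \<in> \<omega> ` R \<omega>)) \<le> (\<Sum>e\<in>R \<omega>. \<omega> e)" .
  qed
  finally have "c * \<Sum>V \<le> (\<Sum>\<omega>\<in>?B. \<Sum>e\<in>R \<omega>. \<omega> e) / real (card ?B)"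
    using fin ne by (simp add: pos_le_divide_eq card_gt_0_iff mult.commute)
  then show ?thesis by (simp add: integral_pmf_of_set[OF ne fin])
qed

text \<open>The first \<open>h\<close> terms are at least \<open>w h\<close> and the other
  \<open>r - h\<close> at most \<open>w h\<close>, so the average over the prefix is no smaller than
  the overall average.\<close>

lemma sum_prefix_ge:
  fixes w :: "nat \<Rightarrow> real"
  assumes "\<And>i j. 1 \<le> i \<Longrightarrow> i < j \<Longrightarrow> j \<le> r \<Longrightarrow> w j \<le> w i" "h \<le> r"
  shows "real h * (\<Sum>i=1..r. w i) \<le> real r * (\<Sum>i=1..h. w i)"
proof (cases "h = 0")
  case False
  have "real h * w h \<le> (\<Sum>i=1..h. w i)"
    using sum_bounded_below[of "{1..h}" "w h" w] assms False by (auto simp: le_less)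
  then have low: "(real r - real h) * (real h * w h) \<le> (real r - real h) * (\<Sum>i=1..h. w i)"
    using assms(2) by (intro mult_left_mono) auto
  have "(\<Sum>i=h+1..r. w i) \<le> (real r - real h) * w h"
    using sum_bounded_above[of "{h+1..r}" w "w h"] assms False by (auto simp: of_nat_diff)
  then have "real h * (\<Sum>i=h+1..r. w i) \<le> (real r - real h) * (real h * w h)"
    using mult_left_mono[of _ _ "real h"] by (subst mult.left_commute) simp
  moreover have "(\<Sum>i=1..r. w i) = (\<Sum>i=1..h. w i) + (\<Sum>i=h+1..r. w i)"
    using sum.ub_add_nat[of 1 h w "r - h"] assms(2) by simp
  ultimately show ?thesis using low by (simp add: algebra_simps)
qed simp

text \<open>Whether an element of \<open>B\<close> beats the threshold depends only on how many
  elements of \<open>A\<close> are heavier. So the competitors of \<open>e\<close> in the greedy run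
  form exactly the set in \<open>card_not_spanned_ge\<close>. The weight \<open>v\<close> passes
  since at most \<open>k\<close> weights in all exceed it.\<close>

lemma (in matroid) sample_greedy_hit:
  fixes \<omega> :: "'a \<Rightarrow> real"
  assumes "distinct es" "set es = E" "inj_on \<omega> E" "k < length es div 2" "k = r div 4"
    and A: "A = set (take (length es div 2) es)" and B: "B = set (drop (length es div 2) es)"
    and v: "card {u\<in>\<omega> ` E. v < u} \<le> k"
    and e: "e \<in> B" "\<omega> e = v" "e \<notin> matroid_span E I {f\<in>B. \<omega> f \<noteq> v \<and> card {h\<in>A. \<omega> f < \<omega> h} \<le> k}"
  shows "v \<in> \<omega> ` sample_greedy I r es \<omega>"
proof -
  let ?a = "take (length es div 2) es" and ?b = "drop (length es div 2) es"
  have E: "A \<union> B = E" "A \<inter> B = {}" "distinct ?a" "distinct ?b"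
    using assms(1,2) set_take_disj_set_drop_if_distinct[OF assms(1) order.refl]
    by (auto simp: A B simp flip: set_append)
  let ?c = "kth_largest (k + 1) (map \<omega> ?a)"
  have above: "?c < \<omega> f \<longleftrightarrow> card {h\<in>A. \<omega> f < \<omega> h} \<le> k" if "f \<in> B" for f
  proof -
    have inj: "inj_on \<omega> A" using assms(3) E(1) inj_on_subset by blast
    have "\<omega> f \<notin> \<omega> ` A" using that E(1,2) assms(3) by (auto simp: inj_on_def)
    then have "?c < \<omega> f \<longleftrightarrow> card {u\<in>\<omega> ` A. \<omega> f < u} \<le> k"
      using kth_largest_less_iff[of "map \<omega> ?a" k "\<omega> f"] assms(4) E(3) inj
      by (simp add: A distinct_map)
    also have "{u\<in>\<omega> ` A. \<omega> f < u} = \<omega> ` {h\<in>A. \<omega> f < \<omega> h}" by auto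
    also have "card \<dots> = card {h\<in>A. \<omega> f < \<omega> h}"
      using inj by (intro card_image) (auto simp: inj_on_def)
    finally show ?thesis .
  qed
  have "card {h\<in>A. v < \<omega> h} \<le> card {u\<in>\<omega> ` E. v < u}"
    using assms(3) E(1) finite_ground
    by (intro card_inj_on_le[of \<omega>]) (auto simp: inj_on_def)
  then have "?c < \<omega> e" using above[OF e(1)] v e(2) by simp
  moreover have "{f\<in>set ?b. ?c < \<omega> f \<and> f \<noteq> e} = {f\<in>B. \<omega> f \<noteq> v \<and> card {h\<in>A. \<omega> f < \<omega> h} \<le> k}"
    using above e(1,2) E(1) assms(3) by (auto simp: inj_on_def B)
  ultimately have "e \<in> greedy_above I ?c \<omega> ?b"
    using mem_greedy_above[OF E(4), of e ?c \<omega>] e E(1) by (auto simp: B)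
  then show ?thesis using e(2) by (auto simp: sample_greedy_def assms(5) Let_def)
qed

lemma sampling_ratio:
  assumes "12 \<le> r" "k = r div 4"
  shows "1 / 40 \<le> (1 - 2 * (real k + 2) / real r) / 2 * ((real k + 1) / real r)"
proof -
  define j where "j = r mod 4"
  have r: "real r = 4 * real k + real j" using div_mult_mod_eq[of r 4] unfolding j_def assms(2) by linarith
  have k: "3 \<le> real k" using assms by auto
  have j: "real j \<ge> 0" "real j \<le> 3" by (auto simp: j_def)
  \<comment> \<open>With \<open>r = 4 * k + j\<close> this is
    \<open>20 * (r - 2 * (k + 2)) * (k + 1) - r * r\<close>, arranged so that every summand is
    nonnegative for \<open>k \<ge> 3\<close> and \<open>0 \<le> j \<le> 3\<close>.\<close>
  have "0 \<le> (real k - 3) * (24 * real k + 32) + 16 + real j * (12 * real k + 17) + real j * (3 - real j)"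
    using k j by (intro add_nonneg_nonneg mult_nonneg_nonneg) auto
  then have "real r * real r \<le> 20 * ((real r - 2 * (real k + 2)) * (real k + 1))"
    unfolding r by (simp add: algebra_simps)
  then have "real r * real r / (40 * (real r * real r)) \<le> 20 * ((real r - 2 * (real k + 2)) * (real k + 1)) / (40 * (real r * real r))"
    by (rule divide_right_mono) simp
  then show ?thesis using assms(1) by (simp add: field_simps)
qed

theorem (in matroid) sample_greedy_expectation:
  fixes w :: "nat \<Rightarrow> real"
  assumes "uniformly_dense E I" "card E = n" "matroid_rank I E = r" "distinct es" "set es = E"
    and w: "\<And>i j. 1 \<le> i \<Longrightarrow> i < j \<Longrightarrow> j \<le> n \<Longrightarrow> w j < w i" "\<And>i. 1 \<le> i \<Longrightarrow> i \<le> n \<Longrightarrow> 0 \<le> w i"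
    and "12 \<le> r"
  shows "1 / 40 * (\<Sum>i=1..r. w i) \<le> measure_pmf.expectation (pmf_of_set (bijections E (w ` {1..n})))
           (\<lambda>\<omega>. \<Sum>e\<in>sample_greedy I r es \<omega>. \<omega> e)"
proof -
  define k where "k = r div 4"
  define W where "W = w ` {1..n}"
  define A B where "A = set (take (length es div 2) es)" and "B = set (drop (length es div 2) es)"
  let ?c = "(1 - 2 * (real k + 2) / real r) / 2"
  have winj: "inj_on w {1..n}" using w(1) by (intro linorder_inj_onI) force+
  have W: "finite W" "card E = card W"
    using card_image[OF winj] assms(2) by (auto simp: W_def)
  have rn: "r \<le> n" using rank_le_card[OF finite_ground] assms(2,3) by simp
  have len: "length es = n" using distinct_card[OF assms(4)] assms(2,5) by simp
  have E: "E = A \<union> B" "A \<inter> B = {}"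
    using assms(5) set_take_disj_set_drop_if_distinct[OF assms(4) order.refl]
    by (auto simp: A_def B_def simp flip: set_append)
  have cA: "card A = n div 2" and cB: "card B = n - n div 2"
    using assms(4) len by (auto simp: A_def B_def distinct_card)
  \<comment> \<open>\<open>k < n div 2\<close> ensures that the sample has the \<open>k + 1\<close>
    elements that the threshold refers to.\<close>
  have kn: "k + 1 \<le> r" "k < n div 2" "2 * (k + 2) \<le> r" using assms(8) rn by (auto simp: k_def)
  have wless: "i < j" if "w j < w i" "i \<in> {1..n}" "j \<in> {1..n}" for i j
    using w(1)[of j i] that by (cases i j rule: linorder_cases) auto
  have main: "?c * \<Sum>(w ` {1..k+1}) \<le> measure_pmf.expectation (pmf_of_set (bijections E W))
           (\<lambda>\<omega>. \<Sum>e\<in>sample_greedy I r es \<omega>. \<omega> e)"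
  proof (rule bijections_expectation_ge[OF finite_ground W])
    show "0 \<le> u" if "u \<in> W" for u using that w(2) by (auto simp: W_def)
    show "sample_greedy I r es \<omega> \<subseteq> E" for \<omega>
      using greedy_above_subset set_drop_subset assms(5) unfolding sample_greedy_def Let_def by fastforce
    show "w ` {1..k+1} \<subseteq> W" using kn(1) rn by (auto simp: W_def)
    fix v assume "v \<in> w ` {1..k+1}"
    then obtain i where i: "1 \<le> i" "i \<le> k + 1" "v = w i" by auto
    have "{u\<in>W. v < u} \<subseteq> w ` {1..<i}"
      using wless i kn(1) rn by (fastforce simp: W_def)
    then have "card {u\<in>W. v < u} \<le> card (w ` {1..<i})" by (intro card_mono) auto
    also have "\<dots> \<le> card {1..<i}" by (rule card_image_le) simp
    finally have top: "card {u\<in>W. v < u} \<le> k" using i by simp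
    have vW: "v \<in> W" using i kn(1) rn by (auto simp: W_def)
    have "?c * real (card (bijections E W)) \<le> real (card {\<omega>\<in>bijections E W. \<exists>e\<in>B. \<omega> e = v \<and>
           e \<notin> matroid_span E I {f\<in>B. \<omega> f \<noteq> v \<and> card {h\<in>A. \<omega> f < \<omega> h} \<le> k}})"
      using cA cB assms(8) by (intro card_not_spanned_ge W E vW assms(1,3) kn(3)) auto
    also have "\<dots> \<le> real (card {\<omega>\<in>bijections E W. v \<in> \<omega> ` sample_greedy I r es \<omega>})"
      unfolding of_nat_le_iff
    proof (rule card_mono, simp add: finite_ground W, safe)
      fix \<omega> e assume w: "\<omega> \<in> bijections E W" and "e \<in> B" "v = \<omega> e"
        "e \<notin> matroid_span E I {f\<in>B. \<omega> f \<noteq> \<omega> e \<and> card {h\<in>A. \<omega> f < \<omega> h} \<le> k}"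
      then show "\<omega> e \<in> \<omega> ` sample_greedy I r es \<omega>"
        using sample_greedy_hit[OF assms(4,5) bijections_inj[OF w] _ k_def A_def B_def _ _ refl, of e]
          top kn(2) len bijections_image[OF w] by simp
    qed
    finally show "?c * real (card (bijections E W)) \<le> real (card {\<omega>\<in>bijections E W. v \<in> \<omega> ` sample_greedy I r es \<omega>})" .
  qed
  have V: "\<Sum>(w ` {1..k+1}) = (\<Sum>i=1..k+1. w i)"
    using kn(1) rn by (intro sum.reindex[unfolded o_def id_def, OF inj_on_subset[OF winj]]) auto
  have "1 / 40 * (\<Sum>i=1..r. w i) \<le> ?c * (\<Sum>i=1..k+1. w i)"
  proof -
    have "0 \<le> (\<Sum>i=1..r. w i)" using w(2) rn by (intro sum_nonneg) auto
    then have "1 / 40 * (\<Sum>i=1..r. w i) \<le> ?c * ((real k + 1) / real r) * (\<Sum>i=1..r. w i)"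
      by (intro mult_right_mono sampling_ratio assms(8) k_def)
    also have "\<dots> = ?c * (real (k + 1) * (\<Sum>i=1..r. w i) / real r)" by (simp add: mult_ac)
    also have "\<dots> \<le> ?c * (\<Sum>i=1..k+1. w i)"
    proof (rule mult_left_mono)
      have "real (k + 1) * (\<Sum>i=1..r. w i) \<le> real r * (\<Sum>i=1..k+1. w i)"
        using w(1) rn kn(1) by (intro sum_prefix_ge) (auto intro: less_imp_le)
      then show "real (k + 1) * (\<Sum>i=1..r. w i) / real r \<le> (\<Sum>i=1..k+1. w i)"
        using assms(8) by (subst pos_divide_le_eq) (auto simp: mult.commute)
      show "0 \<le> ?c" using kn(3) assms(8) by (simp add: divide_le_eq)
    qed
    finally show ?thesis .
  qed
  also have "\<dots> \<le> measure_pmf.expectation (pmf_of_set (bijections E W)) (\<lambda>\<omega>. \<Sum>e\<in>sample_greedy I r es \<omega>. \<omega> e)"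
    using main unfolding V .
  finally show ?thesis unfolding W_def .
qed

section \<open>The classical secretary problem\<close>

lemma relative_ranks_map:
  assumes "\<And>x y. x \<in> set xs \<Longrightarrow> y \<in> set xs \<Longrightarrow> f x \<le> f y \<longleftrightarrow> x \<le> y"
  shows "relative_ranks (map f xs) = relative_ranks xs"
proof -
  have "{i. i \<le> j \<and> map f xs ! j \<le> map f xs ! i} = {i. i \<le> j \<and> xs ! j \<le> xs ! i}" if "j < length xs" for j
    using that assms by (auto simp: order.strict_trans1)
  then show ?thesis unfolding relative_ranks_def by simp
qed

lemma secretary_select_map:
  assumes "\<And>x y. x \<in> set xs \<Longrightarrow> y \<in> set xs \<Longrightarrow> f x \<le> f y \<longleftrightarrow> x \<le> y"
  shows "secretary_select \<tau> (map f xs) = secretary_select \<tau> xs"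
proof -
  have "relative_ranks (take n (map f xs)) = relative_ranks (take n xs)" for n
    unfolding take_map by (intro relative_ranks_map assms) (auto dest: in_set_takeD)
  then show ?thesis by (simp add: secretary_select_def)
qed

lemma secretary_select_less: "secretary_select \<tau> xs = Some t \<Longrightarrow> t < length xs"
  by (auto simp: secretary_select_def find_Some_iff)

lemma selects_maximum_iff:
  "selects_maximum \<tau> xs \<longleftrightarrow> (\<exists>t<length xs. secretary_select \<tau> xs = Some t \<and> (\<forall>x\<in>set xs. x \<le> xs ! t))"
proof -
  have "xs ! t = Max (set xs) \<longleftrightarrow> (\<forall>x\<in>set xs. x \<le> xs ! t)" if "t < length xs" for t
    using that by (auto intro: Max_eqI[symmetric])
  then show ?thesis unfolding selects_maximum_def using secretary_select_less by blast
qed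

lemma selects_maximum_map:
  assumes "\<And>x y. x \<in> set xs \<Longrightarrow> y \<in> set xs \<Longrightarrow> f x \<le> f y \<longleftrightarrow> x \<le> y"
  shows "selects_maximum \<tau> (map f xs) \<longleftrightarrow> selects_maximum \<tau> xs"
proof -
  have key: "(\<forall>x\<in>set (map f xs). x \<le> map f xs ! t) \<longleftrightarrow> (\<forall>x\<in>set xs. x \<le> xs ! t)" if "t < length xs" for t
    using that assms by simp
  then show ?thesis unfolding selects_maximum_iff length_map
    by (intro ex_cong1 conj_cong refl key) (simp add: secretary_select_map assms)
qed

text \<open>\<open>u\<close> sends a weight to its rank in \<open>W\<close> counted from the
  smallest, an order isomorphism onto \<open>{1..n}\<close>. Reading \<omega> along
  \<open>es\<close> and applying \<open>u\<close> thus matches bijections with permutations, and a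
  stopping rule cannot tell the two lists apart.\<close>

lemma secretary_success_eq:
  assumes "distinct es" "set es = E" "finite W" "card W = n" "card E = n"
  shows "secretary_success n \<tau>
    = real (card {\<omega>\<in>bijections E W. selects_maximum \<tau> (map \<omega> es)}) / real (card (bijections E W))"
proof -
  define u where "u = (\<lambda>v. card {x\<in>W. x \<le> v})"
  let ?P = "permutations_of_set {1..n}"
  have finE: "finite E" using assms(2) by auto
  have len: "length es = n" using distinct_card[OF assms(1)] assms(2,5) by simp
  have less: "u x < u y" if "y \<in> W" "x < y" for x y
  proof -
    have "y \<notin> {z\<in>W. z \<le> x}" "y \<in> {z\<in>W. z \<le> y}" "{z\<in>W. z \<le> x} \<subseteq> {z\<in>W. z \<le> y}"
      using that by auto
    then show ?thesis
      unfolding u_def by (intro psubset_card_mono) (simp add: assms(3), blast)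
  qed
  have le: "u x \<le> u y \<longleftrightarrow> x \<le> y" if "x \<in> W" "y \<in> W" for x y
    using less[of x y] less[of y x] that by (cases x y rule: linorder_cases) auto
  have uinj: "inj_on u W"
  proof (rule inj_onI)
    fix x y assume "x \<in> W" "y \<in> W" "u x = u y"
    then show "x = y" using le[of x y] le[of y x] by simp
  qed
  have "u x \<in> {1..n}" if "x \<in> W" for x
  proof -
    have "u x \<le> card W" unfolding u_def using assms(3) by (intro card_mono) auto
    moreover have "u x > 0" unfolding u_def using that assms(3) by (auto simp: card_gt_0_iff)
    ultimately show ?thesis using assms(4) by simp
  qed
  then have uimg: "u ` W = {1..n}"
    using card_image[OF uinj] assms(4) by (intro card_subset_eq) auto
  have bij: "bij_betw (\<lambda>\<omega>. map u (map \<omega> es)) (bijections E W) ?P"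
  proof (intro bij_betw_imageI inj_onI equalityI subsetI)
    fix \<omega> \<omega>' assume w: "\<omega> \<in> bijections E W" "\<omega>' \<in> bijections E W" and eq: "map u (map \<omega> es) = map u (map \<omega>' es)"
    have "\<omega> e = \<omega>' e" if "e \<in> E" for e
    proof -
      have "u (\<omega> e) = u (\<omega>' e)" using eq that assms(2) by auto
      then show ?thesis using inj_onD[OF uinj] bijections_image[OF w(1)] bijections_image[OF w(2)] that by blast
    qed
    then show "\<omega> = \<omega>'" using w by (intro extensionalityI[of _ E]) (auto simp: bijections_def PiE_def)
  next
    fix xs assume "xs \<in> (\<lambda>\<omega>. map u (map \<omega> es)) ` bijections E W"
    then obtain \<omega> where w: "\<omega> \<in> bijections E W" "xs = map u (map \<omega> es)" by blast
    have "set xs = {1..n}" using w bijections_image[OF w(1)] uimg assms(2) by auto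
    moreover have "distinct xs"
      using w(2) calculation len card_distinct[of xs] by simp
    ultimately show "xs \<in> ?P" by (simp add: permutations_of_set_def)
  next
    fix xs assume "xs \<in> ?P"
    then have xs: "set xs = {1..n}" "distinct xs" by (auto simp: permutations_of_set_def)
    define ys where "ys = map (inv_into W u) xs"
    have lys: "length ys = length es" using distinct_card[OF xs(2)] xs(1) len by (simp add: ys_def)
    have uys: "map u ys = xs" using xs(1) uimg by (auto simp: ys_def f_inv_into_f intro!: map_idI)
    have sys: "set ys = W" using inv_into_image_cancel[OF uinj subset_refl] xs(1) uimg by (simp add: ys_def)
    define \<omega> where "\<omega> = restrict (\<lambda>e. the (map_of (zip es ys) e)) E"
    have wys: "map \<omega> es = ys"
      by (rule nth_equalityI) (use lys assms(1,2) in \<open>auto simp: \<omega>_def map_of_zip_nth\<close>)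
    then have img: "\<omega> ` E = W" using assms(2) sys by (metis set_map)
    then have "inj_on \<omega> E" using assms(4,5) finE by (intro eq_card_imp_inj_on) auto
    then have "\<omega> \<in> bijections E W" using img by (auto simp: bijections_def bij_betw_def \<omega>_def)
    then show "xs \<in> (\<lambda>\<omega>. map u (map \<omega> es)) ` bijections E W" using wys uys by (intro image_eqI) auto
  qed
  have "selects_maximum \<tau> (map u (map \<omega> es)) \<longleftrightarrow> selects_maximum \<tau> (map \<omega> es)" if "\<omega> \<in> bijections E W" for \<omega>
    using bijections_image[OF that] le assms(2) by (intro selects_maximum_map) auto
  then have "card {\<omega>\<in>bijections E W. selects_maximum \<tau> (map \<omega> es)} = card {xs\<in>?P. selects_maximum \<tau> xs}"
    by (intro bij_betw_same_card[OF bij_betw_Collect[OF bij]])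
  moreover have "card (bijections E W) = card ?P" by (rule bij_betw_same_card[OF bij])
  moreover have "secretary_success n \<tau> = real (card (?P \<inter> {xs. selects_maximum \<tau> xs})) / real (card ?P)"
    unfolding secretary_success_def by (rule measure_pmf_of_set) auto
  ultimately show ?thesis by (simp add: Int_def)
qed

section \<open>The cutoff rule, a competitor for the optimal rule\<close>

definition cutoff_rule :: "nat \<Rightarrow> stopping_rule" where
  "cutoff_rule s rs \<longleftrightarrow> s < length rs \<and> last rs = 1"

text \<open>When item \<open>t\<close>, counted from 0, arrives, there are \<open>t + 1\<close>
  relative ranks, so the strict \<open>s < length rs\<close> bars exactly the first \<open>s\<close>
  items. As \<open>t\<close> always belongs to \<open>?R\<close>, rank 1 means a strict new
  maximum.\<close>

lemma cutoff_rule_relative_ranks: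
  assumes "t < length xs"
  shows "cutoff_rule s (relative_ranks (take (Suc t) xs)) \<longleftrightarrow> s \<le> t \<and> (\<forall>i<t. xs ! i < xs ! t)"
proof -
  let ?R = "{i. i \<le> t \<and> xs ! t \<le> xs ! i}"
  have "card ?R = 1 \<longleftrightarrow> ?R = {t}"
  proof
    assume "card ?R = 1"
    moreover have "t \<in> ?R" by simp
    ultimately show "?R = {t}" by (metis card_1_singletonE singletonD)
  qed simp
  also have "\<dots> \<longleftrightarrow> (\<forall>i<t. xs ! i < xs ! t)"
  proof
    assume R: "?R = {t}"
    show "\<forall>i<t. xs ! i < xs ! t"
    proof (intro allI impI)
      fix i assume "i < t"
      then have "i \<notin> ?R" unfolding R by simp
      with \<open>i < t\<close> show "xs ! i < xs ! t" by simp
    qed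
  next
    assume "\<forall>i<t. xs ! i < xs ! t"
    then have "i = t" if "i \<le> t" "xs ! t \<le> xs ! i" for i
      using that by (cases "i < t") (auto simp: not_le[symmetric])
    then show "?R = {t}" by auto
  qed
  finally have R: "card ?R = 1 \<longleftrightarrow> (\<forall>i<t. xs ! i < xs ! t)" .
  let ?ys = "take (Suc t) xs"
  have len: "length (relative_ranks ?ys) = Suc t" using assms by (simp add: relative_ranks_def)
  then have "last (relative_ranks ?ys) = relative_ranks ?ys ! t"
    by (subst last_conv_nth) auto
  also have "\<dots> = card {i. i \<le> t \<and> ?ys ! t \<le> ?ys ! i}"
    using assms by (simp add: relative_ranks_def del: nth_take upt_Suc)
  also have "{i. i \<le> t \<and> ?ys ! t \<le> ?ys ! i} = ?R" by auto
  finally show ?thesis using len R by (simp add: cutoff_rule_def less_Suc_eq_le)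
qed

lemma cutoff_selects_maximum:
  assumes "t < length xs" "s \<le> t" "\<And>i. i < length xs \<Longrightarrow> xs ! i \<le> xs ! t"
    and "\<And>i. i < t \<Longrightarrow> xs ! i \<noteq> xs ! t" "\<And>t'. s \<le> t' \<Longrightarrow> t' < t \<Longrightarrow> \<exists>i<t'. xs ! t' \<le> xs ! i"
  shows "selects_maximum (cutoff_rule s) xs"
proof -
  have "secretary_select (cutoff_rule s) xs = Some t"
    unfolding secretary_select_def find_Some_iff
  proof (intro exI[of _ t] conjI allI impI)
    show "cutoff_rule s (relative_ranks (take (Suc ([0..<length xs] ! t)) xs))"
      using assms(1-4) by (auto simp: cutoff_rule_relative_ranks order.strict_iff_order)
    fix t' assume "t' < t"
    then show "\<not> cutoff_rule s (relative_ranks (take (Suc ([0..<length xs] ! t')) xs))"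
      using assms(1,5) by (auto simp: cutoff_rule_relative_ranks not_less)
  qed (use assms in auto)
  then show ?thesis
    using assms(1,3) by (auto simp: selects_maximum_iff in_set_conv_nth)
qed

text \<open>The sum decreases to ln 2, which exceeds 2/3. The term \<open>1 / (3 * s)\<close> makes
  the induction work: it gives equality at \<open>s = 1\<close>, and from \<open>s\<close> to
  \<open>s + 1\<close> the sum drops by \<open>1 / (2 * s * (2 * s + 1))\<close>, at most the drop
  \<open>1 / (3 * s * (s + 1))\<close> of the bound.\<close>

lemma sum_inverse_double_ge:
  assumes "1 \<le> s"
  shows "2 / 3 + 1 / (3 * real s) \<le> (\<Sum>t=s..<2 * s. 1 / real t)"
  using assms
proof (induction s rule: nat_induct_at_least)
  case base
  then show ?case by (simp add: numeral_2_eq_2)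
next
  case (Suc s)
  have s: "1 \<le> real s" using Suc by simp
  have "(\<Sum>t=Suc s..<2 * Suc s. 1 / real t)
      = (\<Sum>t=s..<2 * s. 1 / real t) - 1 / real s + 1 / real (2 * s) + 1 / real (2 * s + 1)"
    using Suc.hyps by (simp add: sum.atLeast_Suc_lessThan)
  moreover have "1 / real s - 1 / real (2 * s) - 1 / real (2 * s + 1) = 1 / (2 * real s * (2 * real s + 1))"
    using s by (simp add: divide_simps add_pos_pos)
  moreover have "1 / (3 * real s) - 1 / (3 * real (Suc s)) = 1 / (3 * real s * (real s + 1))"
    using s by (simp add: divide_simps)
  moreover have "3 * real s * (real s + 1) \<le> 2 * real s * (2 * real s + 1)"
    using mult_left_mono[OF s, of "real s"] by (simp add: algebra_simps)
  then have "1 / (2 * real s * (2 * real s + 1)) \<le> 1 / (3 * real s * (real s + 1))"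
    using s by (intro frac_le) auto
  ultimately show ?case using Suc.IH by linarith
qed

text \<open>The right-hand side is the classical success probability of skipping
  \<open>n div 2\<close> items. For \<open>n = 2 * s + 1\<close> the factor \<open>s / n\<close> is
  below 1/2, which the term \<open>1 / (3 * s)\<close> of \<open>sum_inverse_double_ge\<close> makes
  up for, as \<open>n / (3 * s) = 2 / 3 + 1 / (3 * s)\<close>.\<close>

lemma cutoff_ratio:
  assumes "2 \<le> n"
  shows "1 / 3 \<le> real (n div 2) / real n * (\<Sum>t=n div 2..<n. 1 / real t)"
proof -
  define s where "s = n div 2"
  have s: "1 \<le> s" using assms by (simp add: s_def)
  note H = sum_inverse_double_ge[OF s]
  consider "n = 2 * s" | "n = 2 * s + 1" unfolding s_def by linarith
  then show ?thesis
  proof cases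
    case 1
    then have "real s / real n = 1 / 2" using s by simp
    moreover have "2 / 3 \<le> (\<Sum>t=s..<2 * s. 1 / real t)" using H by (smt (verit) divide_nonneg_nonneg of_nat_0_le_iff)
    ultimately have "1 / 3 \<le> real s / real n * (\<Sum>t=s..<n. 1 / real t)" using 1 by (simp only:)
    then show ?thesis unfolding s_def .
  next
    case 2
    have "real n / (3 * real s) = 2 / 3 + 1 / (3 * real s)" using 2 s by (simp add: field_simps)
    also have "\<dots> \<le> (\<Sum>t=s..<n. 1 / real t)"       by (rule order.trans[OF H], intro sum_mono2) (use 2 in auto)
    finally have "real s / real n * (real n / (3 * real s)) \<le> real s / real n * (\<Sum>t=s..<n. 1 / real t)"
      by (intro mult_left_mono) auto
    then show ?thesis using s 2 unfolding s_def[symmetric] by simp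
  qed
qed

lemma cutoff_success_ge:
  assumes "distinct es" "set es = E" "finite W" "card W = n" "card E = n" "1 \<le> n"
  shows "real (card (bijections E W)) / 3
    \<le> real (card {\<omega>\<in>bijections E W. selects_maximum (cutoff_rule (n div 2)) (map \<omega> es)})"
proof (cases "n = 1")
  case True
  have "length es = 1" using distinct_card[OF assms(1)] assms(2,5) True by simp
  then have "selects_maximum (cutoff_rule (n div 2)) (map \<omega> es)" for \<omega> :: "'a \<Rightarrow> real"
    using True by (intro cutoff_selects_maximum[of 0]) auto
  then show ?thesis by simp
next
  case False
  define s where "s = n div 2"
  define N where "N = real (card (bijections E W))"
  have n: "2 \<le> n" using False assms(6) by simp
  have finE: "finite E" using assms(2) by auto
  have fin: "finite (bijections E W)" using finE assms(3) by simp
  have len: "length es = n" using distinct_card[OF assms(1)] assms(2,5) by simp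
  have esE: "es ! i \<in> E" if "i < n" for i using that len assms(2) by auto
  have "W \<noteq> {}" using assms(4) n by auto
  then have Max: "Max W \<in> W" "\<And>x. x \<in> W \<Longrightarrow> x \<le> Max W" using assms(3) by auto
  \<comment> \<open>In \<open>C (t, j)\<close> the maximum arrives at position \<open>t\<close> and
    the best of the \<open>t\<close> earlier items at position \<open>j\<close>. If
    \<open>j < s \<le> t\<close>, no item from \<open>s\<close> up to \<open>t - 1\<close> is a new
    maximum, so the rule stops at \<open>t\<close>. Each such event has probability at least
    \<open>1 / (n * t)\<close>.\<close>
  define C where "C = (\<lambda>(t, j). {\<omega>\<in>bijections E W. \<omega> (es ! t) = Max W \<and> (\<forall>h\<in>(!) es ` {..<t}. \<omega> h \<le> \<omega> (es ! j))})"
  define J where "J = {s..<n} \<times> {..<s}"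
  have inj: "i = j" if "\<omega> \<in> bijections E W" "\<omega> (es ! i) = \<omega> (es ! j)" "i < n" "j < n" for \<omega> i j
    using inj_onD[OF bijections_inj[OF that(1)] that(2)] esE that(3,4) assms(1) len
    by (auto simp: nth_eq_iff_index_eq)
  have "N / 3 \<le> real s / real n * (\<Sum>t=s..<n. 1 / real t) * N"
    using mult_right_mono[OF cutoff_ratio[OF n], of N] by (simp add: s_def N_def)
  also have "\<dots> = (\<Sum>t=s..<n. \<Sum>j<s. N / (real n * real t))"
    by (simp add: sum_distrib_left sum_distrib_right)
  also have "\<dots> = (\<Sum>p\<in>J. N / (real n * real (fst p)))"
    unfolding J_def sum.cartesian_product by (simp add: case_prod_beta)
  also have "\<dots> \<le> (\<Sum>p\<in>J. real (card (C p)))"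
  proof (rule sum_mono, safe)
    fix t j assume "(t, j) \<in> J"
    then have tj: "s \<le> t" "t < n" "j < s" "j < t" by (auto simp: J_def)
    let ?D = "(!) es ` {..<t}"
    have cD: "card ?D = t"
      using tj(2) len assms(1) by (subst card_image) (auto intro!: inj_on_nth)
    have "card (bijections E W) = n * card {\<omega>\<in>bijections E W. \<omega> (es ! t) = Max W}"
      using card_bijections_point[OF finE assms(3) esE[OF tj(2)] Max(1)] assms(5) by simp
    also have "\<dots> \<le> n * (card ?D * card {\<omega>\<in>bijections E W. \<omega> (es ! t) = Max W \<and> (\<forall>h\<in>?D. \<omega> h \<le> \<omega> (es ! j))})"
      using tj len assms(1) esE
      by (intro mult_le_mono2 card_bijections_max_ge finE assms(3)) (auto simp: nth_eq_iff_index_eq)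
    finally have "card (bijections E W) \<le> n * t * card (C (t, j))"
      by (simp add: cD C_def)
    then have "N \<le> real (n * t * card (C (t, j)))" unfolding N_def of_nat_le_iff .
    then show "N / (real n * real (fst (t, j))) \<le> real (card (C (t, j)))"
      using tj n by (simp add: divide_le_eq mult_ac)
  qed
  also have "\<dots> = real (card (\<Union>p\<in>J. C p))"
  proof -
    \<comment> \<open>By injectivity \<omega> determines \<open>t\<close> as the position of the
      maximum and then \<open>j\<close> as that of the best earlier item.\<close>
    have "C p \<inter> C q = {}" if pq: "p \<in> J" "q \<in> J" "p \<noteq> q" for p q
    proof (rule ccontr)
      assume "C p \<inter> C q \<noteq> {}"
      then obtain \<omega> where w: "\<omega> \<in> C p" "\<omega> \<in> C q" by blast
      obtain t j t' j' where p: "p = (t, j)" "q = (t', j')" by (cases p, cases q) blast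
      have b: "t < n" "t' < n" "j < t" "j' < t'" using pq p by (auto simp: J_def)
      have "t = t'" using w p inj[of \<omega> t t'] b by (auto simp: C_def)
      moreover have "\<omega> (es ! j) = \<omega> (es ! j')"
        using w p b \<open>t = t'\<close> by (auto simp: C_def intro!: order.antisym)
      then have "j = j'" using inj[of \<omega> j j'] w p b by (auto simp: C_def)
      ultimately show False using pq p by simp
    qed
    moreover have "finite (C p)" for p using fin by (auto simp: C_def split: prod.split)
    ultimately show ?thesis by (subst card_UN_disjoint) (auto simp: J_def)
  qed
  also have "\<dots> \<le> real (card {\<omega>\<in>bijections E W. selects_maximum (cutoff_rule s) (map \<omega> es)})"
    unfolding of_nat_le_iff
  proof (rule card_mono)
    show "finite {\<omega>\<in>bijections E W. selects_maximum (cutoff_rule s) (map \<omega> es)}" using fin by simp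
    show "(\<Union>p\<in>J. C p) \<subseteq> {\<omega>\<in>bijections E W. selects_maximum (cutoff_rule s) (map \<omega> es)}"
    proof
      fix \<omega> assume "\<omega> \<in> (\<Union>p\<in>J. C p)"
      then obtain t j where tj: "s \<le> t" "t < n" "j < s" and w: "\<omega> \<in> bijections E W" "\<omega> (es ! t) = Max W"
        and le: "\<And>i. i < t \<Longrightarrow> \<omega> (es ! i) \<le> \<omega> (es ! j)" by (auto simp: J_def C_def)
      have "selects_maximum (cutoff_rule s) (map \<omega> es)"
      proof (rule cutoff_selects_maximum)
        show "t < length (map \<omega> es)" "s \<le> t" using tj len by auto
        show "map \<omega> es ! i \<le> map \<omega> es ! t" if "i < length (map \<omega> es)" for i
          using that tj len w Max(2) bijections_image[OF w(1)] esE by auto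
        show "map \<omega> es ! i \<noteq> map \<omega> es ! t" if "i < t" for i
          using inj[OF w(1), of i t] that tj len by auto
        show "\<exists>i<t'. map \<omega> es ! t' \<le> map \<omega> es ! i" if "s \<le> t'" "t' < t" for t'
          using le[of t'] that tj len by (intro exI[of _ j]) auto
      qed
      then show "\<omega> \<in> {\<omega>\<in>bijections E W. selects_maximum (cutoff_rule s) (map \<omega> es)}" using w by simp
    qed
  qed
  finally show ?thesis by (simp add: N_def s_def)
qed

text \<open>Only the maximum weight is credited, that is \<open>V = {Max W}\<close>. Optimality is
  used through a comparison with the cutoff rule, so the constant is 1/3 instead of 1/e.\<close>

lemma secretary_expectation:
  assumes "distinct es" "set es = E" "finite W" "card W = n" "card E = n" "1 \<le> n"
    and "\<And>u. u \<in> W \<Longrightarrow> 0 \<le> u" "optimal_secretary_rule n \<tau>"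
  shows "1 / 3 * Max W \<le> measure_pmf.expectation (pmf_of_set (bijections E W))
           (\<lambda>\<omega>. \<Sum>e\<in>secretary_output \<tau> es \<omega>. \<omega> e)"
proof -
  let ?B = "bijections E W"
  have finE: "finite E" using assms(2) by auto
  have sub: "secretary_output \<tau> es \<omega> \<subseteq> E" for \<omega> :: "'a \<Rightarrow> real"
    using assms(2) by (auto simp: secretary_output_def dest!: secretary_select_less split: option.splits)
  have "?B \<noteq> {}" using bijections_nonempty[OF finE assms(3)] assms(4,5) by simp
  then have pos: "0 < card ?B" using finE assms(3) by (simp add: card_gt_0_iff)
  have "W \<noteq> {}" using assms(4,6) by auto
  then have Max: "Max W \<in> W" using assms(3) by simp
  have "1 / 3 * real (card ?B) \<le> real (card {\<omega>\<in>?B. selects_maximum \<tau> (map \<omega> es)})"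
  proof -
    have "secretary_success n (cutoff_rule (n div 2)) \<le> secretary_success n \<tau>"
      using assms(8) by (simp add: optimal_secretary_rule_def)
    then have "real (card {\<omega>\<in>?B. selects_maximum (cutoff_rule (n div 2)) (map \<omega> es)})
        \<le> real (card {\<omega>\<in>?B. selects_maximum \<tau> (map \<omega> es)})"
      using pos unfolding secretary_success_eq[OF assms(1-5)] by (simp add: divide_le_cancel)
    then show ?thesis using cutoff_success_ge[OF assms(1-6)] by simp
  qed
  also have "\<dots> \<le> real (card {\<omega>\<in>?B. Max W \<in> \<omega> ` secretary_output \<tau> es \<omega>})"
    unfolding of_nat_le_iff
  proof (rule card_mono)
    show "finite {\<omega>\<in>?B. Max W \<in> \<omega> ` secretary_output \<tau> es \<omega>}" using finE assms(3) by simp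
    show "{\<omega>\<in>?B. selects_maximum \<tau> (map \<omega> es)} \<subseteq> {\<omega>\<in>?B. Max W \<in> \<omega> ` secretary_output \<tau> es \<omega>}"
    proof clarify
      fix \<omega> assume w: "\<omega> \<in> ?B" "selects_maximum \<tau> (map \<omega> es)"
      then obtain t where "secretary_select \<tau> (map \<omega> es) = Some t" "map \<omega> es ! t = Max W"
        using bijections_image[OF w(1)] assms(2) by (auto simp: selects_maximum_def)
      then show "Max W \<in> \<omega> ` secretary_output \<tau> es \<omega>"
        using secretary_select_less[of \<tau> "map \<omega> es" t] by (simp add: secretary_output_def)
    qed
  qed
  finally have "1 / 3 * \<Sum>{Max W} \<le> measure_pmf.expectation (pmf_of_set ?B) (\<lambda>\<omega>. \<Sum>e\<in>secretary_output \<tau> es \<omega>. \<omega> e)"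
    using Max sub by (intro bijections_expectation_ge[OF finE assms(3)] assms(7)) (auto simp: assms(4,5))
  then show ?thesis by simp
qed

section \<open>The approximation guarantee\<close>

theorem theorem1:
  fixes E :: "'a set" and I :: "'a set set" and n r :: nat
    and es :: "'a list" and w :: "nat \<Rightarrow> real" and \<tau> :: stopping_rule
  assumes "matroid E I"
    and "uniformly_dense E I"
    and "card E = n"
    and "matroid_rank I E = r"
    and "distinct es" and "set es = E"
    and "\<And>i j. 1 \<le> i \<Longrightarrow> i < j \<Longrightarrow> j \<le> n \<Longrightarrow> w j < w i"
    and "\<And>i. 1 \<le> i \<Longrightarrow> i \<le> n \<Longrightarrow> 0 \<le> w i"
    and "optimal_secretary_rule n \<tau>"
  shows "measure_pmf.expectation (pmf_of_set (bijections E (w ` {1..n})))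
           (\<lambda>\<omega>. \<Sum>e\<in>ALG E I \<tau> es \<omega>. \<omega> e)
         \<ge> 1 / 40 * (\<Sum>i=1..r. w i)"
proof -
  interpret matroid E I by (rule assms(1))
  let ?W = "w ` {1..n}"
  have inj: "inj_on w {1..n}" using assms(7) by (intro linorder_inj_onI) force+
  have cW: "card ?W = n" using card_image[OF inj] by simp
  have rn: "r \<le> n" using rank_le_card[OF finite_ground] assms(3,4) by simp
  consider "12 \<le> r" | "r = 0" | "1 \<le> r" "r < 12" by linarith
  then show ?thesis
  proof cases
    case 1
    then show ?thesis
      using sample_greedy_expectation[OF assms(2-8)] by (simp add: ALG_def assms(4))
  next
    case 2
    \<comment> \<open>For \<open>r = 0\<close> the target sum is empty, so nonnegativity suffices;
      this case also covers an empty ground set.\<close>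
    have "0 \<le> measure_pmf.expectation (pmf_of_set (bijections E ?W)) (\<lambda>\<omega>. \<Sum>e\<in>secretary_output \<tau> es \<omega>. \<omega> e)"
    proof (rule integral_nonneg_AE, rule AE_pmfI)
      fix \<omega> assume "\<omega> \<in> set_pmf (pmf_of_set (bijections E ?W))"
      then have "\<omega> \<in> bijections E ?W"
        using bijections_nonempty[of E ?W] finite_ground assms(3) cW by simp
      then have "\<omega> e \<in> ?W" if "e \<in> E" for e
        using bijections_image that by blast
      then have "0 \<le> \<omega> e" if "e \<in> E" for e
        using that assms(8) by fastforce
      then show "0 \<le> (\<Sum>e\<in>secretary_output \<tau> es \<omega>. \<omega> e)"
        using assms(6) by (auto simp: secretary_output_def dest!: secretary_select_less split: option.splits)
    qed
    then show ?thesis using 2 by (simp add: ALG_def assms(4))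
  next
    case 3
    have mono: "w i \<le> w 1" if "1 \<le> i" "i \<le> n" for i
      using assms(7)[of 1 i] that by (cases "i = 1") auto
    then have Max: "Max ?W = w 1" using 3 rn by (intro Max_eqI) auto
    \<comment> \<open>There are at most 11 terms, each at most \<open>w 1\<close>, and 11/40 is
      below 1/3.\<close>
    have "(\<Sum>i=1..r. w i) \<le> real r * w 1"
      using sum_bounded_above[of "{1..r}" w "w 1"] mono rn by simp
    also have "\<dots> \<le> 11 * w 1"
      using 3 rn assms(8)[of 1] by (intro mult_right_mono) auto
    finally have "1 / 40 * (\<Sum>i=1..r. w i) \<le> 1 / 3 * Max ?W"
      using 3 rn assms(8)[of 1] Max by simp
    also have "\<dots> \<le> measure_pmf.expectation (pmf_of_set (bijections E ?W)) (\<lambda>\<omega>. \<Sum>e\<in>secretary_output \<tau> es \<omega>. \<omega> e)"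
      using 3 rn assms(3,8,9) cW by (intro secretary_expectation[of es E ?W n] assms(5,6)) auto
    finally show ?thesis using 3 by (simp add: ALG_def assms(4))
  qed
qed

end
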